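(* Let $n\ge 2$ and $0<q<n$ with $\gcd(q,n)=1$, and let $V=\mathbb C^2/\mu_n$, where $\mu_n$ (the $n$-th roots of unity) acts by $\xi(u_1,u_2)=(\xi^q u_1,\xi u_2)$, with singular point $p$ the image of the origin. Then $(V,p)$ is metrically conical if and only if it is homogeneous, i.e. if and only if $q=1$.
   Context: The germ $(V,p)$ is equipped with its inner metric: choosing generators $z_1,\dots,z_N$ of the local ring $\mathcal O_{(V,p)}$ gives an embedding $(V,p)\to(\mathbb C^N,0)$, and the distance between two points is the infimum of lengths of paths within $V$ measured with the standard metric of $\mathbb C^N$ (independent of choices up to bi-Lipschitz equivalence). For a smooth compact manifold $M$, the cone $CM$ is the metric completion of $\mathbb R_+\times M$ with metric $ds^2=dt^2+t^2ds_M^2$ for a Riemannian metric $ds_M$ on $M$. $(V,p)$ is metrically conical if it is bi-Lipschitz homeomorphic, as a germ, to the cone $CM$ on its link $M$ at the cone point. The cyclic quotient singularity $\mathbb C^2/\mu_n$ is called homogeneous when, with respect to the $\mathbb C^*$-action induced by the diagonal action on $\mathbb C^2$, all minimal homogeneous generators of its coordinate ring have equal weight; this holds exactly when $q=1$. *)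

theory Defs
  imports "HOL-Analysis.Analysis"
begin

definition cdist :: "complex list \<Rightarrow> complex list \<Rightarrow> real" where
  "cdist x y = sqrt (\<Sum>i<length x. (cmod (x ! i - y ! i))\<^sup>2)"

definition cnorm :: "complex list \<Rightarrow> real" where
  "cnorm x = cdist x (replicate (length x) 0)"

definition ccontinuous_on :: "real set \<Rightarrow> (real \<Rightarrow> complex list) \<Rightarrow> bool" where
  "ccontinuous_on A g \<longleftrightarrow>
     (\<forall>s\<in>A. \<forall>e>0. \<exists>d>0. \<forall>s'\<in>A. \<bar>s' - s\<bar> < d \<longrightarrow> cdist (g s') (g s) < e)"

definition curve_length :: "(real \<Rightarrow> complex list) \<Rightarrow> ereal" where
  "curve_length g =
     (SUP p \<in> {(k, t). t 0 = 0 \<and> t k = (1::real) \<and> (\<forall>i<k. t i \<le> t (Suc i))}.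
        ereal (\<Sum>i<fst p. cdist (g (snd p i)) (g (snd p (Suc i)))))"

definition inner_dist :: "complex list set \<Rightarrow> complex list \<Rightarrow> complex list \<Rightarrow> ereal" where
  "inner_dist S x y =
     (INF g \<in> {g. ccontinuous_on {0..1} g \<and> g 0 = x \<and> g 1 = y \<and> g ` {0..1} \<subseteq> S}.
        curve_length g)"

text \<open>Exponents (a,b) of invariant monomials u1^a u2^b (q a + b = 0 mod n) with
  1 <= a+b <= n; these generate the maximal ideal of the invariant ring (Noether bound).\<close>
definition mons :: "nat \<Rightarrow> nat \<Rightarrow> (nat \<times> nat) list" where
  "mons n q = [(a, b). a \<leftarrow> [0..<Suc n], b \<leftarrow> [0..<Suc n],
                1 \<le> a + b \<and> a + b \<le> n \<and> (q * a + b) mod n = 0]"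

definition embed :: "nat \<Rightarrow> nat \<Rightarrow> complex \<times> complex \<Rightarrow> complex list" where
  "embed n q u = map (\<lambda>(a, b). fst u ^ a * snd u ^ b) (mons n q)"

definition quotV :: "nat \<Rightarrow> nat \<Rightarrow> complex list set" where
  "quotV n q = range (embed n q)"

definition singpt :: "nat \<Rightarrow> nat \<Rightarrow> complex list" where
  "singpt n q = embed n q (0, 0)"

definition link :: "nat \<Rightarrow> nat \<Rightarrow> real \<Rightarrow> complex list set" where
  "link n q \<epsilon> = {x \<in> quotV n q. cnorm x = \<epsilon>}"

text \<open>None is the cone point; Some (t,x) with t>0 is the point at radius t over x.
  The metric is the completion of dt^2 + t^2 ds_M^2.\<close>
definition cone_points :: "'a set \<Rightarrow> (real \<times> 'a) option set" where
  "cone_points M = {None} \<union> {Some (t, x) | t x. t > 0 \<and> x \<in> M}"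

fun cone_radius :: "(real \<times> 'a) option \<Rightarrow> real" where
  "cone_radius None = 0"
| "cone_radius (Some (t, x)) = t"

definition cap_pi :: "ereal \<Rightarrow> real" where
  "cap_pi d = (if d \<ge> ereal pi then pi else real_of_ereal d)"

fun cone_dist :: "('a \<Rightarrow> 'a \<Rightarrow> ereal) \<Rightarrow> (real \<times> 'a) option \<Rightarrow> (real \<times> 'a) option \<Rightarrow> real" where
  "cone_dist d None None = 0"
| "cone_dist d None (Some (s, y)) = s"
| "cone_dist d (Some (t, x)) None = t"
| "cone_dist d (Some (t, x)) (Some (s, y)) =
     sqrt (t\<^sup>2 + s\<^sup>2 - 2 * t * s * cos (cap_pi (d x y)))"

definition metrically_conical :: "nat \<Rightarrow> nat \<Rightarrow> bool" where
  "metrically_conical n q \<longleftrightarrow>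
    (\<exists>\<epsilon>>0. \<exists>r>0. \<exists>\<delta>>0. \<exists>K\<ge>1. \<exists>U h.
       let V = quotV n q; M = link n q \<epsilon>; dM = inner_dist M in
       {x \<in> V. cnorm x < r} \<subseteq> U \<and> U \<subseteq> V \<and>
       h ` U \<subseteq> cone_points M \<and>
       {P \<in> cone_points M. cone_radius P < \<delta>} \<subseteq> h ` U \<and>
       inj_on h U \<and> h (singpt n q) = None \<and>
       (\<forall>x\<in>U. \<forall>y\<in>U.
          ereal (cone_dist dM (h x) (h y)) \<le> ereal K * inner_dist V x y \<and>
          inner_dist V x y \<le> ereal K * ereal (cone_dist dM (h x) (h y))))"

end

theory Submission
  imports Defs
begin

text \<open>For \<open>q = 1\<close> all invariant monomials have degree \<open>n\<close>, so \<open>V\<close> is a cone in the ambient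
  space and polar coordinates are bi-Lipschitz from the inner metric to the cone over the link.

  For \<open>q > 1\<close> some mixed monomial \<open>u\<^sub>1\<^sup>a u\<^sub>2\<^sup>b\<close> strictly dominates all others along the tori
  \<open>|u\<^sub>1| = \<tau>\<^bsup>n+2\<^esup>\<close>, \<open>|u\<^sub>2| = \<tau>\<^bsup>n+1\<^esup>\<close>. On such a torus there is an arc along which this monomial
  is constant and whose endpoints are distinct points of one orbit. Its image in \<open>V\<close> is a loop at
  distance about \<open>\<tau>\<^sup>w\<close> from the singular point, but of length \<open>O(\<tau>\<^bsup>w+1\<^esup>)\<close> (a fast loop). A
  bi-Lipschitz chart to a cone maps it, for small \<open>\<tau>\<close>, into a product of a radius interval and a
  small ball of the link. That product is simply connected, hence the inverse of the chart lifts over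
  it to the universal cover \<open>\<complex>\<^sup>2 - {0}\<close> of \<open>V - {p}\<close>, so the loop would lift to a closed loop;
  but it lifts to the arc.\<close>

section \<open>Inner distances and cone distances\<close>

text \<open>On a torus \<open>|u1| = |u2|\<close> invariant monomials of equal degree have equal
  size, so a unique dominant one need not exist. The tilt between the exponents n + 2 and n + 1
  breaks ties by the exponent of u1, and since all orders are integers the dominant monomial wins by
  a full power of \<tau>. A bi-Lipschitz constant cannot close this gap: in the cone the loop has
  radius at least \<tau>^w / K and length O(\<tau>^(w+1)), so its trace in the link has diameter
  O(\<tau>). For q = 1 the same recipe selects u2^n, whose arc is already closed upstairs. The
  remaining obstacle is uniformity: the trace may wander in the link as \<tau> tends to 0, while the
  ball containing it needs a size independent of \<tau>. Compactness supplies a limit point w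
  upstairs; a ball about w is fixed, and only then \<tau> is chosen. Parametrising part of the link
  by this ball makes its product with a radius interval convex, so simple connectivity is immediate.
  The chart is merely an injection with metric bounds; continuity of its inverse comes from the
  upper bound on the inner metric.\<close>

lemma cdist_L2_set: "cdist x y = L2_set (\<lambda>i. cmod (x ! i - y ! i)) {..<length x}"
  by (simp add: cdist_def L2_set_def)

lemma cnorm_L2_set: "cnorm x = L2_set (\<lambda>i. cmod (x ! i)) {..<length x}"
  unfolding cnorm_def cdist_L2_set by (intro L2_set_cong) auto

lemma cdist_nonneg [simp]: "0 \<le> cdist x y"
  by (simp add: cdist_L2_set)

lemma cnorm_nonneg [simp]: "0 \<le> cnorm x"
  by (simp add: cnorm_L2_set)

lemma cdist_self [simp]: "cdist x x = 0"
  by (simp add: cdist_L2_set L2_set_eq_0_iff)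

lemma cdist_commute: "length x = length y \<Longrightarrow> cdist x y = cdist y x"
  by (simp add: cdist_L2_set norm_minus_commute)

lemma cdist_triangle:
  assumes "length x = length y"
  shows "cdist x z \<le> cdist x y + cdist y z"
proof -
  have "cdist x z \<le> L2_set (\<lambda>i. cmod (x ! i - y ! i) + cmod (y ! i - z ! i)) {..<length x}"
    unfolding cdist_L2_set
    by (intro L2_set_mono) (auto intro: norm_diff_triangle_le)
  also have "\<dots> \<le> cdist x y + cdist y z"
    unfolding cdist_L2_set using assms by (metis L2_set_triangle_ineq)
  finally show ?thesis .
qed

lemma nth_le_cdist: "i < length x \<Longrightarrow> cmod (x ! i - y ! i) \<le> cdist x y"
  unfolding cdist_L2_set
  using member_le_L2_set[of "{..<length x}" i "\<lambda>i. cmod (x ! i - y ! i)"] by simp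

lemma nth_le_cnorm: "i < length x \<Longrightarrow> cmod (x ! i) \<le> cnorm x"
  unfolding cnorm_L2_set
  using member_le_L2_set[of "{..<length x}" i "\<lambda>i. cmod (x ! i)"] by simp

lemma cdist_le_length_mult:
  assumes "\<And>i. i < length x \<Longrightarrow> cmod (x ! i - y ! i) \<le> B"
  shows "cdist x y \<le> real (length x) * B"
proof -
  have "cdist x y \<le> (\<Sum>i<length x. cmod (x ! i - y ! i))"
    unfolding cdist_L2_set by (rule L2_set_le_sum) auto
  also have "\<dots> \<le> (\<Sum>i<length x. B)"
    using assms by (intro sum_mono) auto
  finally show ?thesis by simp
qed

lemma cdist_eq_0_iff:
  assumes "length x = length y"
  shows "cdist x y = 0 \<longleftrightarrow> x = y"
  using assms by (auto simp: cdist_L2_set L2_set_eq_0_iff list_eq_iff_nth_eq)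

lemma cnorm_diff_le:
  assumes "length x = length y"
  shows "cnorm x \<le> cdist x y + cnorm y"
  unfolding cnorm_def using cdist_triangle[OF assms, of "replicate (length x) 0"] assms by simp

lemma cdist_le_cnorm_add:
  assumes "length x = length y"
  shows "cdist x y \<le> cnorm x + cnorm y"
  using cdist_triangle[of x "replicate (length x) 0" y] cdist_commute[of y "replicate (length x) 0"]
    assms by (simp add: cnorm_def)

lemma cnorm_eq_0_iff: "cnorm x = 0 \<longleftrightarrow> x = replicate (length x) 0"
  unfolding cnorm_def by (rule cdist_eq_0_iff) simp

section \<open>Real dilations of coordinate vectors\<close>

definition dilate :: "real \<Rightarrow> complex list \<Rightarrow> complex list" where
  "dilate c x = map (\<lambda>z. of_real c * z) x"

lemma length_dilate [simp]: "length (dilate c x) = length x"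
  by (simp add: dilate_def)

lemma nth_dilate [simp]: "i < length x \<Longrightarrow> dilate c x ! i = of_real c * x ! i"
  by (simp add: dilate_def)

lemma dilate_1 [simp]: "dilate 1 x = x"
  by (simp add: dilate_def)

lemma dilate_dilate: "dilate a (dilate b x) = dilate (a * b) x"
  by (simp add: dilate_def mult.assoc)

lemma cnorm_dilate: "cnorm (dilate c x) = \<bar>c\<bar> * cnorm x"
  by (simp add: cnorm_L2_set L2_set_right_distrib norm_mult cong: L2_set_cong_simp)

lemma cdist_dilate_left: "cdist (dilate a x) (dilate b x) = \<bar>a - b\<bar> * cnorm x"
proof -
  have "cmod (dilate a x ! i - dilate b x ! i) = \<bar>a - b\<bar> * cmod (x ! i)" if "i < length x" for i
    using that by (simp flip: left_diff_distrib of_real_diff add: norm_mult)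
  then show ?thesis
    by (simp add: cdist_L2_set cnorm_L2_set L2_set_right_distrib cong: L2_set_cong_simp)
qed

lemma cdist_dilate_right:
  assumes "length x = length y"
  shows "cdist (dilate c x) (dilate c y) = \<bar>c\<bar> * cdist x y"
proof -
  have "cmod (dilate c x ! i - dilate c y ! i) = \<bar>c\<bar> * cmod (x ! i - y ! i)" if "i < length x" for i
    using that assms by (simp flip: right_diff_distrib add: norm_mult)
  then show ?thesis
    by (simp add: cdist_L2_set L2_set_right_distrib cong: L2_set_cong_simp)
qed

text \<open>The detour through \<open>dilate b x\<close> separates a radial move from a move at
  constant scale.\<close>

lemma cdist_dilate_le:
  assumes "length x = length y"
  shows "cdist (dilate a x) (dilate b y) \<le> \<bar>a - b\<bar> * cnorm x + \<bar>b\<bar> * cdist x y"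
  using cdist_triangle[of "dilate a x" "dilate b x" "dilate b y"] cdist_dilate_right[OF assms, of b]
    cdist_dilate_left[of a x b] by simp

section \<open>Curve length and the inner metric\<close>

lemma partition_in_unit_interval:
  fixes t :: "nat \<Rightarrow> real"
  assumes "t 0 = 0" "t k = 1" "\<forall>i<k. t i \<le> t (Suc i)" "i \<le> k"
  shows "t i \<in> {0..1}"
proof -
  have mono: "t i \<le> t j" if "i \<le> j" "j \<le> k" for i j
    using that assms(3) by (induction j rule: dec_induct) (auto intro: order_trans)
  show ?thesis using mono[of 0 i] mono[of i k] assms by auto
qed

lemma curve_length_le:
  assumes "\<And>k t. \<lbrakk>t 0 = 0; t k = 1; \<forall>i<k. t i \<le> t (Suc i)\<rbrakk>
      \<Longrightarrow> (\<Sum>i<k. cdist (g (t i)) (g (t (Suc i)))) \<le> L"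
  shows "curve_length g \<le> ereal L"
  unfolding curve_length_def using assms by (intro SUP_least) auto

lemma sum_le_curve_length:
  assumes "t 0 = 0" "t k = 1" "\<forall>i<k. t i \<le> t (Suc i)"
  shows "ereal (\<Sum>i<k. cdist (g (t i)) (g (t (Suc i)))) \<le> curve_length g"
  unfolding curve_length_def using assms by (intro SUP_upper2[of "(k, t)"]) auto

text \<open>This is the partition 0, s, 1. It confines a short curve to a neighbourhood of its ends,
  which later keeps such a curve away from the singular point.\<close>

lemma cdist_endpoints_le_curve_length:
  assumes "s \<in> {0..1}"
  shows "ereal (cdist (g 0) (g s) + cdist (g s) (g 1)) \<le> curve_length g"
  using sum_le_curve_length[of "\<lambda>i. if i = 0 then 0 else if i = 1 then s else 1" 2 g] assms
  by (simp add: numeral_2_eq_2)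

lemma inner_dist_le_curve:
  assumes "ccontinuous_on {0..1} g" "g 0 = x" "g 1 = y" "g ` {0..1} \<subseteq> S" "curve_length g \<le> L"
  shows "inner_dist S x y \<le> L"
  unfolding inner_dist_def using assms by (intro INF_lower2[of g]) auto

text \<open>The summand \<open>A\<close> accounts for a reparametrised radial motion superimposed on \<open>g\<close>.\<close>

lemma inner_dist_le_compare:
  assumes cont: "ccontinuous_on {0..1} g"
    and len: "curve_length g \<le> ereal l"
    and cmp: "\<And>s s'. \<lbrakk>s \<in> {0..1}; s' \<in> {0..1}\<rbrakk>
      \<Longrightarrow> cdist (G s) (G s') \<le> A * \<bar>s - s'\<bar> + B * cdist (g s) (g s')"
    and nonneg: "0 \<le> A" "0 \<le> B"
    and ends: "G 0 = x" "G 1 = y" "G ` {0..1} \<subseteq> S"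
  shows "inner_dist S x y \<le> ereal (A + B * l)"
proof (rule inner_dist_le_curve[OF _ ends])
  show "ccontinuous_on {0..1} G"
    unfolding ccontinuous_on_def
  proof (intro ballI allI impI)
    fix s e :: real
    assume s: "s \<in> {0..1}" and e: "e > 0"
    \<comment> \<open>The 1 keeps the denominator positive when \<open>A = B = 0\<close>; the 2
      makes the final inequality strict.\<close>
    define e' where "e' = e / (2 * (A + B + 1))"
    have e': "e' > 0" using e nonneg by (simp add: e'_def)
    obtain d where d: "d > 0"
      "\<And>s'. s' \<in> {0..1} \<Longrightarrow> \<bar>s' - s\<bar> < d \<Longrightarrow> cdist (g s') (g s) < e'"
      using cont s e' unfolding ccontinuous_on_def by meson
    have "cdist (G s') (G s) < e" if s': "s' \<in> {0..1}" "\<bar>s' - s\<bar> < min d e'" for s'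
    proof -
      have "cdist (G s') (G s) \<le> A * \<bar>s' - s\<bar> + B * cdist (g s') (g s)"
        using cmp s s' by simp
      also have "\<dots> \<le> A * e' + B * e'"
        using d(2)[of s'] s' nonneg by (intro add_mono mult_left_mono) auto
      also have "\<dots> \<le> (A + B + 1) * e'" using e' by (simp add: algebra_simps)
      also have "\<dots> < e" using e nonneg by (simp add: e'_def field_simps add_pos_nonneg)
      finally show ?thesis .
    qed
    then show "\<exists>d>0. \<forall>s'\<in>{0..1}. \<bar>s' - s\<bar> < d \<longrightarrow> cdist (G s') (G s) < e"
      using d(1) e' by (intro exI[of _ "min d e'"]) auto
  qed
  show "curve_length G \<le> ereal (A + B * l)"
  proof (rule curve_length_le)
    fix k and t :: "nat \<Rightarrow> real"
    assume t: "t 0 = 0" "t k = 1" "\<forall>i<k. t i \<le> t (Suc i)"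
    have tI: "t i \<in> {0..1}" if "i \<le> k" for i
      using partition_in_unit_interval[OF t that] .
    have "(\<Sum>i<k. cdist (G (t i)) (G (t (Suc i))))
        \<le> (\<Sum>i<k. A * (t (Suc i) - t i) + B * cdist (g (t i)) (g (t (Suc i))))"
    proof (rule sum_mono)
      fix i assume "i \<in> {..<k}"
      then have "cdist (G (t i)) (G (t (Suc i)))
          \<le> A * \<bar>t i - t (Suc i)\<bar> + B * cdist (g (t i)) (g (t (Suc i)))"
        and "t i \<le> t (Suc i)"
        using cmp[OF tI tI, of i "Suc i"] t by auto
      then show "cdist (G (t i)) (G (t (Suc i)))
          \<le> A * (t (Suc i) - t i) + B * cdist (g (t i)) (g (t (Suc i)))" by simp
    qed
    also have "\<dots> = A * (t k - t 0) + B * (\<Sum>i<k. cdist (g (t i)) (g (t (Suc i))))"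
      by (simp add: sum.distrib sum_lessThan_telescope flip: sum_distrib_left)
    also have "\<dots> \<le> A + B * l"
      using order_trans[OF sum_le_curve_length[OF t, of g] len] t nonneg
      by (simp add: mult_left_mono)
    finally show "(\<Sum>i<k. cdist (G (t i)) (G (t (Suc i)))) \<le> A + B * l" .
  qed
qed

lemma inner_dist_le_lipschitz:
  assumes "\<And>s s'. \<lbrakk>s \<in> {0..1}; s' \<in> {0..1}\<rbrakk> \<Longrightarrow> cdist (G s) (G s') \<le> L * \<bar>s - s'\<bar>"
    and "0 \<le> L" "G 0 = x" "G 1 = y" "G ` {0..1} \<subseteq> S"
  shows "inner_dist S x y \<le> ereal L"
proof -
  \<comment> \<open>A constant comparison curve has length 0, so only the linear summand of the
    comparison estimate survives.\<close>
  have "curve_length (\<lambda>_. []) \<le> ereal 0" by (rule curve_length_le) simp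
  moreover have "ccontinuous_on {0..1} (\<lambda>_. [])"
    unfolding ccontinuous_on_def by (auto intro: exI[of _ 1])
  ultimately show ?thesis
    using inner_dist_le_compare[of "\<lambda>_. []" 0 G L 0 x y S] assms by simp
qed

lemma cdist_le_inner_dist: "ereal (cdist x y) \<le> inner_dist S x y"
  unfolding inner_dist_def
proof (rule INF_greatest, clarsimp)
  fix g :: "real \<Rightarrow> complex list"
  show "ereal (cdist (g 0) (g 1)) \<le> curve_length g"
    using cdist_endpoints_le_curve_length[of 1 g] by simp
qed

lemma inner_dist_nonneg [simp]: "0 \<le> inner_dist S x y"
  using order_trans[OF _ cdist_le_inner_dist[of x y S], of 0] by simp

lemma inner_dist_less_obtain:
  assumes "inner_dist S x y < L"
  obtains g where "ccontinuous_on {0..1} g" "g 0 = x" "g 1 = y" "g ` {0..1} \<subseteq> S"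
    "curve_length g < L"
  using assms unfolding inner_dist_def INF_less_iff by blast

section \<open>The cone metric compared with radius and angle\<close>

lemma jordan_sin_le:
  assumes "0 \<le> x" "x \<le> pi"
  shows "x / pi \<le> sin (x / 2)"
proof -
  define c where "c = x / pi"
  have c: "0 \<le> c" "c \<le> 1" using assms by (auto simp: c_def)
  have "concave_on {0..pi} sin"
    by (rule f''_le0_imp_concave[where f' = cos and f'' = "\<lambda>x. - sin x"])
      (auto intro!: derivative_eq_intros sin_ge_zero)
  \<comment> \<open>Over \<open>{0..pi / 2}\<close> the sine lies above its chord, here parametrised
    by \<open>c\<close>.\<close>
  from concave_onD[OF this c, of 0 "pi / 2"] show ?thesis
    by (simp add: c_def)
qed

lemma cap_pi_nonneg: "0 \<le> d \<Longrightarrow> 0 \<le> cap_pi d"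
  by (simp add: cap_pi_def real_of_ereal_pos)

lemma cap_pi_le_pi: "0 \<le> d \<Longrightarrow> cap_pi d \<le> pi"
  by (cases d) (auto simp: cap_pi_def)

lemma cap_pi_le: "0 \<le> d \<Longrightarrow> d \<le> ereal L \<Longrightarrow> cap_pi d \<le> L"
  by (cases d) (auto simp: cap_pi_def)

lemma ereal_cap_pi: "0 \<le> d \<Longrightarrow> cap_pi d < pi \<Longrightarrow> ereal (cap_pi d) = d"
  by (cases d) (auto simp: cap_pi_def split: if_splits)

text \<open>Substituting 1 - cos c = 2 sin^2 (c/2) into the law of cosines splits the squared
  distance into a radial and an angular summand, both nonnegative for nonnegative radii, which can
  then be estimated separately.\<close>

lemma cone_dist_Some_eq:
  "cone_dist d (Some (t, x)) (Some (s, y))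
    = sqrt ((t - s)\<^sup>2 + 4 * t * s * (sin (cap_pi (d x y) / 2))\<^sup>2)"
proof -
  have "cos (cap_pi (d x y)) = 1 - 2 * (sin (cap_pi (d x y) / 2))\<^sup>2"
    using cos_double_sin[of "cap_pi (d x y) / 2"] by simp
  then have "t\<^sup>2 + s\<^sup>2 - 2 * t * s * cos (cap_pi (d x y))
      = (t - s)\<^sup>2 + 4 * t * s * (sin (cap_pi (d x y) / 2))\<^sup>2"
    by (simp only: power2_eq_square) (simp add: algebra_simps)
  then show ?thesis by simp
qed

lemma abs_diff_le_cone_dist:
  assumes "0 \<le> t" "0 \<le> s"
  shows "\<bar>t - s\<bar> \<le> cone_dist d (Some (t, x)) (Some (s, y))"
  unfolding cone_dist_Some_eq using assms by (intro real_le_rsqrt) simp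

text \<open>The factor \<open>2 / pi\<close> is Jordan's bound sin (c/2) \<ge> c / pi, available
  because the capped angle never exceeds pi.\<close>

lemma angle_le_cone_dist:
  assumes "0 \<le> t" "0 \<le> s" "0 \<le> d x y"
  shows "2 / pi * sqrt (t * s) * cap_pi (d x y) \<le> cone_dist d (Some (t, x)) (Some (s, y))"
  unfolding cone_dist_Some_eq
proof (rule real_le_rsqrt)
  have "cap_pi (d x y) / pi \<le> sin (cap_pi (d x y) / 2)"
    using jordan_sin_le cap_pi_nonneg cap_pi_le_pi assms(3) by blast
  then have "(cap_pi (d x y) / pi)\<^sup>2 \<le> (sin (cap_pi (d x y) / 2))\<^sup>2"
    using cap_pi_nonneg[OF assms(3)] by (intro power_mono) auto
  then have "4 * t * s * (cap_pi (d x y) / pi)\<^sup>2 \<le> 4 * t * s * (sin (cap_pi (d x y) / 2))\<^sup>2"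
    using assms by (intro mult_left_mono) auto
  moreover have "(2 / pi * sqrt (t * s) * cap_pi (d x y))\<^sup>2 = 4 * t * s * (cap_pi (d x y) / pi)\<^sup>2"
    using assms by (simp add: power_mult_distrib power_divide)
  ultimately show "(2 / pi * sqrt (t * s) * cap_pi (d x y))\<^sup>2
      \<le> (t - s)\<^sup>2 + 4 * t * s * (sin (cap_pi (d x y) / 2))\<^sup>2"
    by (smt (verit) zero_le_power2)
qed

lemma cone_dist_le:
  assumes "0 \<le> t" "0 \<le> s" "0 \<le> d x y"
  shows "cone_dist d (Some (t, x)) (Some (s, y)) \<le> \<bar>t - s\<bar> + sqrt (t * s) * cap_pi (d x y)"
  unfolding cone_dist_Some_eq
proof (rule real_le_lsqrt)
  define c where "c = cap_pi (d x y)"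
  have c: "0 \<le> c" using cap_pi_nonneg assms by (simp add: c_def)
  have "(sin (c / 2))\<^sup>2 \<le> (c / 2)\<^sup>2"
    using abs_sin_x_le_abs_x[of "c / 2"] by (simp only: abs_le_square_iff)
  then have "4 * t * s * (sin (c / 2))\<^sup>2 \<le> 4 * t * s * (c / 2)\<^sup>2"
    using assms by (intro mult_left_mono) auto
  also have "\<dots> = (sqrt (t * s) * c)\<^sup>2"
    using assms by (simp add: power_mult_distrib power_divide)
  finally have "4 * t * s * (sin (c / 2))\<^sup>2 \<le> (sqrt (t * s) * c)\<^sup>2" .
  moreover have "(\<bar>t - s\<bar> + sqrt (t * s) * c)\<^sup>2
      = (t - s)\<^sup>2 + (sqrt (t * s) * c)\<^sup>2 + 2 * (\<bar>t - s\<bar> * (sqrt (t * s) * c))"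
    by (simp add: power2_sum)
  moreover have "0 \<le> \<bar>t - s\<bar> * (sqrt (t * s) * c)"
    using c assms by simp
  ultimately show "(t - s)\<^sup>2 + 4 * t * s * (sin (cap_pi (d x y) / 2))\<^sup>2
      \<le> (\<bar>t - s\<bar> + sqrt (t * s) * cap_pi (d x y))\<^sup>2"
    unfolding c_def by linarith
  show "0 \<le> \<bar>t - s\<bar> + sqrt (t * s) * cap_pi (d x y)"
    using c assms by (simp add: c_def)
qed

lemma cone_dist_le_radii:
  assumes "0 \<le> t" "0 \<le> s"
  shows "cone_dist d (Some (t, x)) (Some (s, y)) \<le> t + s"
proof -
  have "t * s * - 1 \<le> t * s * cos (cap_pi (d x y))"
    using assms by (intro mult_left_mono) auto
  then have "t\<^sup>2 + s\<^sup>2 - 2 * t * s * cos (cap_pi (d x y)) \<le> (t + s)\<^sup>2"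
    by (simp add: power2_eq_square algebra_simps)
  then show ?thesis using assms by (simp add: real_le_lsqrt)
qed

text \<open>From angle pi on, the shortest connection runs through the cone point. This includes
  points at infinite inner distance in the link.\<close>

lemma cone_dist_antipodal:
  assumes "0 \<le> t" "0 \<le> s" "ereal pi \<le> d x y"
  shows "cone_dist d (Some (t, x)) (Some (s, y)) = t + s"
proof -
  have "cap_pi (d x y) = pi" using assms by (simp add: cap_pi_def)
  then have "t\<^sup>2 + s\<^sup>2 - 2 * t * s * cos (cap_pi (d x y)) = (t + s)\<^sup>2"
    by (simp add: power2_eq_square algebra_simps)
  then show ?thesis using assms by simp
qed

section \<open>The homogeneous case\<close>

lemma mons_iff: "(a, b) \<in> set (mons n q) \<longleftrightarrow> 1 \<le> a + b \<and> a + b \<le> n \<and> (q * a + b) mod n = 0"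
proof -
  have "(a, b) \<in> set (mons n q)
      \<longleftrightarrow> a < Suc n \<and> b < Suc n \<and> 1 \<le> a + b \<and> a + b \<le> n \<and> (q * a + b) mod n = 0"
    unfolding mons_def by (simp del: mod_eq_0_iff_dvd upt_Suc)
  then show ?thesis by linarith
qed

lemma length_embed [simp]: "length (embed n q u) = length (mons n q)"
  by (simp add: embed_def)

lemma nth_embed:
  assumes "i < length (mons n q)" "mons n q ! i = (a, b)"
  shows "embed n q u ! i = fst u ^ a * snd u ^ b"
  using assms by (simp add: embed_def)

lemma nth_mons:
  assumes "i < length (mons n q)"
  obtains a b where "mons n q ! i = (a, b)" "1 \<le> a + b" "a + b \<le> n" "(q * a + b) mod n = 0"
  using nth_mem[OF assms] mons_iff[of _ _ n q] by (metis surj_pair)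

lemma embed_in_quotV [simp]: "embed n q u \<in> quotV n q"
  by (simp add: quotV_def)

lemma length_quotV: "x \<in> quotV n q \<Longrightarrow> length x = length (mons n q)"
  by (auto simp: quotV_def)

lemma singpt_eq: "singpt n q = replicate (length (mons n q)) 0"
proof (rule nth_equalityI)
  fix i assume "i < length (singpt n q)"
  then have i: "i < length (mons n q)" by (simp add: singpt_def)
  obtain a b where "mons n q ! i = (a, b)" "1 \<le> a + b" using nth_mons[OF i] by metis
  then show "singpt n q ! i = replicate (length (mons n q)) 0 ! i"
    using i by (auto simp: singpt_def nth_embed power_0_left)
qed (simp add: singpt_def)

lemma cnorm_singpt [simp]: "cnorm (singpt n q) = 0"
  by (simp add: cnorm_eq_0_iff singpt_eq)

lemma singpt_in_quotV [simp]: "singpt n q \<in> quotV n q"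
  by (simp add: singpt_def)

lemma cnorm_eq_0_quotV: "x \<in> quotV n q \<Longrightarrow> cnorm x = 0 \<longleftrightarrow> x = singpt n q"
  by (simp add: cnorm_eq_0_iff singpt_eq length_quotV)

text \<open>All coordinates are homogeneous of degree n in u, so multiplying u by an n-th root of c
  multiplies every coordinate by c.\<close>

lemma dilate_in_quotV:
  assumes "x \<in> quotV n 1" "0 \<le> c" "n \<ge> 1"
  shows "dilate c x \<in> quotV n 1"
proof -
  obtain u1 u2 where x: "x = embed n 1 (u1, u2)" using assms by (auto simp: quotV_def)
  define r where "r = complex_of_real (root n c)"
  have r: "r ^ n = of_real c"
    using assms by (simp add: r_def real_root_pow_pos2 flip: of_real_power)
  have "dilate c x = embed n 1 (r * u1, r * u2)"
  proof (rule nth_equalityI)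
    fix i assume "i < length (dilate c x)"
    then have i: "i < length (mons n 1)" by (simp add: x)
    obtain a b where ab: "mons n 1 ! i = (a, b)" "1 \<le> a + b" "a + b \<le> n" "(1 * a + b) mod n = 0"
      using nth_mons[OF i] by metis
    \<comment> \<open>For q = 1 the degree is itself a multiple of n, and it lies between 1 and
      n.\<close>
    then have "a + b = n" by (cases "a + b = n") auto
    then have "r ^ a * r ^ b = of_real c" using r by (simp flip: power_add)
    then show "dilate c x ! i = embed n 1 (r * u1, r * u2) ! i"
      using i ab by (simp add: x nth_embed power_mult_distrib mult.assoc mult.left_commute)
  qed (simp add: x)
  then show ?thesis by simp
qed

lemma inner_dist_le_through_origin:
  assumes "x \<in> quotV n 1" "y \<in> quotV n 1" "n \<ge> 1"
  shows "inner_dist (quotV n 1) x y \<le> ereal (2 * (cnorm x + cnorm y))"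
proof -
  have len: "length x = length y" using assms length_quotV by metis
  \<comment> \<open>Each ray takes half of the unit interval, which doubles the speed and accounts
    for the factor 2.\<close>
  define G where "G s = (if s \<le> 1 / 2 then dilate (1 - 2 * s) x else dilate (2 * s - 1) y)" for s :: real
  have *: "cdist (G s) (G s') \<le> 2 * (cnorm x + cnorm y) * \<bar>s - s'\<bar>" if "s \<le> s'" for s s'
  proof -
    consider "s' \<le> 1 / 2" | "s \<le> 1 / 2" "1 / 2 < s'" | "1 / 2 < s" using that by linarith
    then show ?thesis
    proof cases
      case 1
      then have "cdist (G s) (G s') = \<bar>2 * s' - 2 * s\<bar> * cnorm x"
        using that by (simp add: G_def cdist_dilate_left)
      also have "\<dots> = 2 * (cnorm x * \<bar>s - s'\<bar>)" using that by simp
      also have "\<dots> \<le> 2 * ((cnorm x + cnorm y) * \<bar>s - s'\<bar>)"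
        by (intro mult_left_mono mult_right_mono) auto
      finally show ?thesis by (simp only: mult.assoc)
    next
      case 2
      then have "cdist (G s) (G s') \<le> (1 - 2 * s) * cnorm x + (2 * s' - 1) * cnorm y"
        using cdist_le_cnorm_add[of "G s" "G s'"] len by (simp add: G_def cnorm_dilate)
      also have "\<dots> \<le> (2 * (s' - s)) * cnorm x + (2 * (s' - s)) * cnorm y"
        using 2 by (intro add_mono mult_right_mono) auto
      also have "\<dots> = 2 * (cnorm x + cnorm y) * \<bar>s - s'\<bar>" using that by (simp add: algebra_simps)
      finally show ?thesis .
    next
      case 3
      then have "cdist (G s) (G s') = \<bar>2 * s - 2 * s'\<bar> * cnorm y"
        using that by (simp add: G_def cdist_dilate_left)
      also have "\<dots> = 2 * (cnorm y * \<bar>s - s'\<bar>)" using that by simp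
      also have "\<dots> \<le> 2 * ((cnorm x + cnorm y) * \<bar>s - s'\<bar>)"
        by (intro mult_left_mono mult_right_mono) auto
      finally show ?thesis by (simp only: mult.assoc)
    qed
  qed
  have "cdist (G s) (G s') \<le> 2 * (cnorm x + cnorm y) * \<bar>s - s'\<bar>" for s s'
    using *[of s s'] *[of s' s] cdist_commute[of "G s" "G s'"] len
    by (cases "s \<le> s'") (auto simp: G_def abs_minus_commute)
  moreover have "G ` {0..1} \<subseteq> quotV n 1"
    using assms dilate_in_quotV by (auto simp: G_def)
  moreover have "G 0 = x" "G 1 = y" by (auto simp: G_def)
  ultimately show ?thesis by (intro inner_dist_le_lipschitz) auto
qed

text \<open>Two kinds of paths are used. If the angle is capped or the radii differ by a factor of
  at least 2, going through the origin is good enough. Otherwise a nearly shortest curve of the link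
  is followed while the radius is interpolated linearly.\<close>

lemma inner_dist_homogeneous_le:
  fixes t s :: real
  assumes n: "n \<ge> 1" and a: "a \<in> link n 1 1" and b: "b \<in> link n 1 1" and t: "t > 0" and s: "s > 0"
  defines "D \<equiv> cone_dist (inner_dist (link n 1 1)) (Some (t, a)) (Some (s, b))"
  shows "inner_dist (quotV n 1) (dilate t a) (dilate s b) \<le> ereal (6 * D)"
proof -
  let ?V = "quotV n 1" and ?M = "link n 1 1"
  have aV: "a \<in> ?V" "cnorm a = 1" and bV: "b \<in> ?V" "cnorm b = 1"
    using a b by (auto simp: link_def)
  have radial: "\<bar>t - s\<bar> \<le> D" unfolding D_def using t s by (intro abs_diff_le_cone_dist) auto
  have org: "inner_dist ?V (dilate t a) (dilate s b) \<le> ereal (2 * (t + s))"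
    using inner_dist_le_through_origin[of "dilate t a" n "dilate s b"] aV bV t s n dilate_in_quotV
    by (simp add: cnorm_dilate)
  show ?thesis
  proof (cases "ereal pi \<le> inner_dist ?M a b \<or> 2 * s \<le> t \<or> 2 * t \<le> s")
    case True
    \<comment> \<open>A capped angle gives \<open>D = t + s\<close>; if one radius is at least twice
      the other, t + s \<le> 3 |t - s|.\<close>
    then have "t + s \<le> 3 * D"
      using cone_dist_antipodal[of t s "inner_dist ?M" a b] radial t s by (auto simp: D_def)
    then show ?thesis by (intro order_trans[OF org]) simp
  next
    case False
    define d where "d = cap_pi (inner_dist ?M a b)"
    have d: "ereal d = inner_dist ?M a b" "0 \<le> d" 
      using False cap_pi_nonneg[of "inner_dist ?M a b"]
      by (cases "inner_dist ?M a b"; simp add: d_def cap_pi_def; fail)+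
    define m where "m = max t s"
    have m: "m > 0" using t s by (simp add: m_def)
    have "inner_dist ?V (dilate t a) (dilate s b) \<le> ereal (\<bar>t - s\<bar> + m * d)"
    proof (rule ereal_le_epsilon2)
      fix e :: real assume e: "0 < e"
      \<comment> \<open>The infimum need not be attained. The excess is divided by \<open>m\<close>
        because the link curve is scaled by radii up to \<open>m\<close>.\<close>
      have "inner_dist ?M a b < ereal (d + e / m)" using d(1)[symmetric] e m by simp
      then obtain g where g: "ccontinuous_on {0..1} g" "g 0 = a" "g 1 = b" "g ` {0..1} \<subseteq> ?M"
        "curve_length g < ereal (d + e / m)"
        using inner_dist_less_obtain by blast
      have gM: "g u \<in> ?V" "cnorm (g u) = 1" "length (g u) = length (mons n 1)" if "u \<in> {0..1}" for u
      proof -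
        have "g u \<in> ?M" using g(4) that by blast
        then show "g u \<in> ?V" "cnorm (g u) = 1" "length (g u) = length (mons n 1)"
          using length_quotV by (auto simp: link_def)
      qed
      define r where "r u = t + u * (s - t)" for u
      have r: "0 \<le> r u" "r u \<le> m" if "u \<in> {0..1}" for u
      proof -
        have "r u = (1 - u) * t + u * s" by (simp add: r_def algebra_simps)
        moreover have "(1 - u) * t + u * s \<le> (1 - u) * m + u * m"
          using that by (intro add_mono mult_left_mono) (auto simp: m_def)
        moreover have "0 \<le> (1 - u) * t + u * s" using that t s by simp
        ultimately show "0 \<le> r u" "r u \<le> m" by (auto simp: algebra_simps)
      qed
      have "inner_dist ?V (dilate t a) (dilate s b) \<le> ereal (\<bar>t - s\<bar> + m * (d + e / m))"
      proof (rule inner_dist_le_compare[OF g(1), where G = "\<lambda>u. dilate (r u) (g u)"])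
        fix u v :: real assume uv: "u \<in> {0..1}" "v \<in> {0..1}"
        have "r u - r v = (u - v) * (s - t)" by (simp add: r_def algebra_simps)
        then have "\<bar>r u - r v\<bar> = \<bar>t - s\<bar> * \<bar>u - v\<bar>" by (simp add: abs_mult abs_minus_commute)
        moreover have "r v * cdist (g u) (g v) \<le> m * cdist (g u) (g v)"
          using r uv by (intro mult_right_mono) auto
        ultimately show "cdist (dilate (r u) (g u)) (dilate (r v) (g v))
            \<le> \<bar>t - s\<bar> * \<bar>u - v\<bar> + m * cdist (g u) (g v)"
          using cdist_dilate_le[of "g u" "g v" "r u" "r v"] gM uv r by simp
      next
        show "(\<lambda>u. dilate (r u) (g u)) ` {0..1} \<subseteq> ?V"
          using gM r n by (auto intro!: dilate_in_quotV simp del: One_nat_def)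
      qed (use g m in \<open>auto simp: r_def\<close>)
      then show "inner_dist ?V (dilate t a) (dilate s b) \<le> ereal (\<bar>t - s\<bar> + m * d) + ereal e"
        using m by (simp add: algebra_simps)
    qed
    moreover have "\<bar>t - s\<bar> + m * d \<le> 6 * D"
    proof -
      \<comment> \<open>The smaller radius exceeds half of the larger one, so the maximum is
        comparable with the geometric mean that governs the angular part of the cone metric.\<close>
      have "m\<^sup>2 \<le> 4 * (t * s)"
      proof (cases "t \<le> s")
        case True
        then show ?thesis using False t s mult_right_mono[of s "4 * t" s]
          by (simp add: m_def power2_eq_square)
      next
        case f: False
        then show ?thesis using False t s mult_left_mono[of t "4 * s" t]
          by (simp add: m_def power2_eq_square)
      qed
      then have "m \<le> 2 * sqrt (t * s)"
        using real_le_rsqrt[of m "4 * (t * s)"] by (simp add: real_sqrt_mult)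
      then have "m * d \<le> 2 * (sqrt (t * s) * d)"
        using mult_right_mono[of m "2 * sqrt (t * s)" d] d(2) by simp
      also have "2 * (sqrt (t * s) * d) = pi * (2 / pi * sqrt (t * s) * d)" by simp
      also have "\<dots> \<le> pi * D"
        using angle_le_cone_dist[of t s "inner_dist ?M" a b] t s
        by (intro mult_left_mono) (auto simp: D_def d_def)
      \<comment> \<open>Together with the radial part this gives 5 D; the constant 6 is dictated by
        the path through the origin, with 2 (t + s) \<le> 6 D.\<close>
      also have "\<dots> \<le> 4 * D" using radial pi_less_4 by (intro mult_right_mono) auto
      finally show ?thesis using radial by simp
    qed
    ultimately show ?thesis by (meson order_trans ereal_less_eq(3))
  qed
qed

text \<open>A curve of length L that may come near the origin has both end radii at most 2 L, so D
  \<le> t + s \<le> 4 L. Any other curve stays outside radius m / 2, where normalising to the link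
  is Lipschitz with constant 4 / m; adding the radial part yields L + 4 L.\<close>

lemma cone_dist_homogeneous_le:
  fixes t s :: real
  assumes n: "n \<ge> 1" and a: "a \<in> link n 1 1" and b: "b \<in> link n 1 1" and t: "t > 0" and s: "s > 0"
  defines "D \<equiv> cone_dist (inner_dist (link n 1 1)) (Some (t, a)) (Some (s, b))"
  shows "ereal D \<le> 5 * inner_dist (quotV n 1) (dilate t a) (dilate s b)"
proof (rule ccontr)
  let ?V = "quotV n 1" and ?M = "link n 1 1"
  have aV: "a \<in> ?V" "cnorm a = 1" and bV: "b \<in> ?V" "cnorm b = 1"
    using a b by (auto simp: link_def)
  assume "\<not> ?thesis"
  then have "inner_dist ?V (dilate t a) (dilate s b) < ereal (D / 5)"
    by (cases "inner_dist ?V (dilate t a) (dilate s b)") auto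
  then obtain L where L: "inner_dist ?V (dilate t a) (dilate s b) < ereal L" "L < D / 5"
    using ereal_dense2 by (metis less_ereal.simps(1))
  then obtain g where g: "ccontinuous_on {0..1} g" "g 0 = dilate t a" "g 1 = dilate s b"
    "g ` {0..1} \<subseteq> ?V" "curve_length g < ereal L"
    using inner_dist_less_obtain by metis
  have gV: "g u \<in> ?V" "length (g u) = length (mons n 1)" if "u \<in> {0..1}" for u
    using g(4) that length_quotV[of "g u" n 1] by blast+
  have ends: "cdist (g 0) (g u) + cdist (g u) (g 1) \<le> L" if "u \<in> {0..1}" for u
    using order.trans[OF cdist_endpoints_le_curve_length[OF that, of g] less_imp_le[OF g(5)]] by simp
  have n01: "cnorm (g 0) = t" "cnorm (g 1) = s" using g aV bV t s by (auto simp: cnorm_dilate)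
  define m where "m = max t s"
  have m: "m > 0" using t s by (simp add: m_def)
  have L0: "0 \<le> L" using order_trans[OF cdist_nonneg, of "g 0" "g 1" L] ends[of 0] by simp
  have "D \<le> 5 * L"
  proof (cases "m \<le> 2 * L")
    case True
    have "D \<le> t + s" unfolding D_def using t s by (intro cone_dist_le_radii) auto
    then show ?thesis using True L0 by (auto simp: m_def)
  next
    case False
    \<comment> \<open>One end has norm \<open>m\<close>, and a length below m / 2 does not suffice
      to descend further.\<close>
    have ge: "m / 2 \<le> cnorm (g u)" if u: "u \<in> {0..1}" for u
    proof -
      have "cnorm (g 0) \<le> cdist (g 0) (g u) + cnorm (g u)"
        and "cnorm (g 1) \<le> cdist (g u) (g 1) + cnorm (g u)"
        using cnorm_diff_le[of "g 0" "g u"] cnorm_diff_le[of "g 1" "g u"] cdist_commute[of "g u" "g 1"]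
          gV[OF u] gV[of 0] gV[of 1] by auto
      moreover note ends[OF u] n01 False cdist_nonneg[of "g 0" "g u"] cdist_nonneg[of "g u" "g 1"]
      ultimately show ?thesis unfolding m_def by linarith
    qed
    have "inner_dist ?M a b \<le> ereal (0 + 4 / m * L)"
    proof (rule inner_dist_le_compare[OF g(1), where G = "\<lambda>u. dilate (1 / cnorm (g u)) (g u)"])
      show "curve_length g \<le> ereal L" using g by simp
    next
      fix u v :: real assume uv: "u \<in> {0..1}" "v \<in> {0..1}"
      define p p' where pp: "p = cnorm (g u)" "p' = cnorm (g v)"
      have p: "m / 2 \<le> p" "m / 2 \<le> p'" using ge uv by (auto simp: pp)
      have d: "\<bar>p' - p\<bar> \<le> cdist (g u) (g v)"
        using cnorm_diff_le[of "g u" "g v"] cnorm_diff_le[of "g v" "g u"] cdist_commute[of "g u" "g v"]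
          gV[of u] gV[of v] uv by (auto simp: pp)
      have "cdist (dilate (1 / p) (g u)) (dilate (1 / p') (g v))
          \<le> \<bar>1 / p - 1 / p'\<bar> * p + \<bar>1 / p'\<bar> * cdist (g u) (g v)"
        unfolding pp using gV uv by (intro cdist_dilate_le) metis
      also have "\<bar>1 / p - 1 / p'\<bar> * p = \<bar>(1 / p - 1 / p') * p\<bar>"
        using p m by (simp add: abs_mult)
      also have "(1 / p - 1 / p') * p = (p' - p) / p'"
        using p m by (simp add: field_simps)
      also have "\<bar>(p' - p) / p'\<bar> = 1 / p' * \<bar>p' - p\<bar>" using p m by simp
      also have "\<dots> + \<bar>1 / p'\<bar> * cdist (g u) (g v) \<le> 1 / p' * cdist (g u) (g v) + 1 / p' * cdist (g u) (g v)"
        using p m d by (intro add_mono mult_left_mono) auto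
      also have "\<dots> = 2 / p' * cdist (g u) (g v)" by simp
      also have "\<dots> \<le> 4 / m * cdist (g u) (g v)"
        using p m by (intro mult_right_mono) (auto simp: field_simps)
      finally show "cdist (dilate (1 / cnorm (g u)) (g u)) (dilate (1 / cnorm (g v)) (g v))
          \<le> 0 * \<bar>u - v\<bar> + 4 / m * cdist (g u) (g v)" by (simp add: pp)
    next
      show "(\<lambda>u. dilate (1 / cnorm (g u)) (g u)) ` {0..1} \<subseteq> ?M"
      proof (rule image_subsetI)
        fix u :: real assume "u \<in> {0..1}"
        then show "dilate (1 / cnorm (g u)) (g u) \<in> ?M"
          using gV[of u] ge[of u] m n dilate_in_quotV[of "g u" n "1 / cnorm (g u)"]
          by (simp add: link_def cnorm_dilate)
      qed
    qed (use m g aV bV t s in \<open>auto simp: cnorm_dilate dilate_dilate\<close>)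
    then have cap: "cap_pi (inner_dist ?M a b) \<le> 4 / m * L"
      by (intro cap_pi_le) auto
    have "sqrt (t * s) \<le> m"
      using t s mult_mono[of t m s m] by (intro real_le_lsqrt) (auto simp: m_def power2_eq_square)
    then have "sqrt (t * s) * cap_pi (inner_dist ?M a b) \<le> m * (4 / m * L)"
      using cap m L0 t s by (intro mult_mono) (auto intro: cap_pi_nonneg)
    moreover have "\<bar>t - s\<bar> \<le> L"
      using cnorm_diff_le[of "g 0" "g 1"] cnorm_diff_le[of "g 1" "g 0"] cdist_commute[of "g 0" "g 1"]
        gV[of 0] gV[of 1] ends[of 0] n01 by auto
    moreover have "D \<le> \<bar>t - s\<bar> + sqrt (t * s) * cap_pi (inner_dist ?M a b)"
      unfolding D_def using t s by (intro cone_dist_le) auto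
    ultimately show ?thesis using m by simp
  qed
  then show False using L by simp
qed

text \<open>Since dilations preserve the whole of V, polar coordinates form a global chart. The
  bounds with constants 5 and 6 are merged into 6.\<close>

lemma metrically_conical_homogeneous:
  assumes n: "n \<ge> 1"
  shows "metrically_conical n 1"
proof -
  let ?V = "quotV n 1" and ?M = "link n 1 1"
  let ?D = "cone_dist (inner_dist ?M)"
  define h where "h x = (if cnorm x = 0 then None else Some (cnorm x, dilate (1 / cnorm x) x))" for x
  have dir: "dilate (1 / cnorm x) x \<in> ?M" if "x \<in> ?V" "cnorm x \<noteq> 0" for x
    using that n dilate_in_quotV[of x n "1 / cnorm x"] by (auto simp: link_def cnorm_dilate)
  have polar: "dilate (cnorm x) (dilate (1 / cnorm x) x) = x" if "cnorm x \<noteq> 0" for x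
    using that by (simp add: dilate_dilate)
  have img: "h ` ?V = cone_points ?M"
  proof
    show "h ` ?V \<subseteq> cone_points ?M"
      using dir by (auto simp: h_def cone_points_def less_le)
    show "cone_points ?M \<subseteq> h ` ?V"
    proof
      fix P assume "P \<in> cone_points ?M"
      then consider "P = None" | t x where "P = Some (t, x)" "t > 0" "x \<in> ?M"
        by (auto simp: cone_points_def)
      then show "P \<in> h ` ?V"
      proof cases
        case 1
        then show ?thesis by (intro image_eqI[of _ _ "singpt n 1"]) (auto simp: h_def)
      next
        case 2
        then have "h (dilate t x) = P" "dilate t x \<in> ?V"
          using n dilate_in_quotV by (auto simp: h_def link_def cnorm_dilate dilate_dilate)
        then show ?thesis by blast
      qed
    qed
  qed
  have inj: "inj_on h ?V"
  proof (rule inj_onI)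
    fix x y assume xy: "x \<in> ?V" "y \<in> ?V" "h x = h y"
    show "x = y"
    proof (cases "cnorm x = 0")
      case True
      then have "cnorm y = 0" using xy by (auto simp: h_def split: if_splits)
      then show ?thesis using True xy cnorm_eq_0_quotV by blast
    next
      case False
      then have "cnorm y = cnorm x" "dilate (1 / cnorm y) y = dilate (1 / cnorm x) x"
        using xy by (auto simp: h_def split: if_splits)
      then show ?thesis using polar[of x] polar[of y] False by metis
    qed
  qed
  have bounds: "ereal (?D (h x) (h y)) \<le> ereal 6 * inner_dist ?V x y \<and>
      inner_dist ?V x y \<le> ereal 6 * ereal (?D (h x) (h y))"
    if xy: "x \<in> ?V" "y \<in> ?V" for x y
  proof (cases "cnorm x = 0 \<or> cnorm y = 0")
    case True
    have len: "length x = length y" using xy length_quotV by metis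
    have D: "?D (h x) (h y) = cnorm x + cnorm y"
      using True by (auto simp: h_def)
    have "cnorm x + cnorm y \<le> cdist x y"
      using True cnorm_diff_le[of x y] cnorm_diff_le[of y x] cdist_commute[of x y] len by auto
    then have lo: "ereal (?D (h x) (h y)) \<le> inner_dist ?V x y"
      using cdist_le_inner_dist[of x y ?V] D by (metis ereal_less_eq(3) order_trans)
    also have "\<dots> \<le> ereal 6 * inner_dist ?V x y"
      by (cases "inner_dist ?V x y") (use inner_dist_nonneg[of ?V x y] in auto)
    finally have 1: "ereal (?D (h x) (h y)) \<le> ereal 6 * inner_dist ?V x y" .
    have "inner_dist ?V x y \<le> ereal (2 * (cnorm x + cnorm y))"
      using inner_dist_le_through_origin xy n by blast
    also have "\<dots> \<le> ereal (6 * (cnorm x + cnorm y))"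
      using cnorm_nonneg[of x] cnorm_nonneg[of y] by simp
    finally show ?thesis using 1 D by simp
  next
    case False
    then have pos: "cnorm x > 0" "cnorm y > 0" by (auto simp: less_le)
    define a b where ab: "a = dilate (1 / cnorm x) x" "b = dilate (1 / cnorm y) y"
    have M: "a \<in> ?M" "b \<in> ?M" using dir xy False by (auto simp: ab)
    have h: "h x = Some (cnorm x, a)" "h y = Some (cnorm y, b)" using False by (auto simp: h_def ab)
    have p: "dilate (cnorm x) a = x" "dilate (cnorm y) b = y" using polar False by (auto simp: ab)
    have "ereal (?D (h x) (h y)) \<le> 5 * inner_dist ?V x y"
      using cone_dist_homogeneous_le[OF n M pos] h p by simp
    also have "\<dots> \<le> ereal 6 * inner_dist ?V x y"
      by (cases "inner_dist ?V x y") (use inner_dist_nonneg[of ?V x y] in auto)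
    finally show ?thesis
      using inner_dist_homogeneous_le[OF n M pos] h p by simp
  qed
  show ?thesis
    unfolding metrically_conical_def Let_def
    using img inj bounds
    by (intro exI[of _ 1] exI[of _ 6] conjI exI[of _ ?V] exI[of _ h]) (auto simp: h_def)
qed

section \<open>The orbit covering\<close>

definition act :: "nat \<Rightarrow> complex \<Rightarrow> complex \<times> complex \<Rightarrow> complex \<times> complex" where
  "act q \<xi> u = (\<xi> ^ q * fst u, \<xi> * snd u)"

text \<open>Three invariant monomials that already separate the orbits.\<close>

definition coords :: "nat \<Rightarrow> nat \<Rightarrow> complex \<times> complex \<Rightarrow> complex \<times> complex \<times> complex" where
  "coords n q u = (fst u ^ n, snd u ^ n, fst u * snd u ^ (n - q))"

lemma act_act: "act q \<xi> (act q \<zeta> u) = act q (\<xi> * \<zeta>) u"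
  by (simp add: act_def power_mult_distrib mult.assoc)

lemma act_1 [simp]: "act q 1 u = u"
  by (simp add: act_def)

lemma act_eq_0_iff: "\<xi> \<noteq> 0 \<Longrightarrow> act q \<xi> u = 0 \<longleftrightarrow> u = 0"
  by (cases u) (auto simp: act_def zero_prod_def)

lemma dist_act:
  assumes "norm \<xi> = 1"
  shows "dist (act q \<xi> u) (act q \<xi> v) = dist u v"
proof -
  have "dist (act q \<xi> u) (act q \<xi> v)
      = sqrt ((norm (\<xi> ^ q * (fst u - fst v)))\<^sup>2 + (norm (\<xi> * (snd u - snd v)))\<^sup>2)"
    by (simp add: dist_prod_def act_def dist_norm algebra_simps)
  then show ?thesis
    using assms by (simp add: norm_mult norm_power dist_prod_def dist_norm)
qed

lemma norm_root_of_unity: "\<xi> ^ n = 1 \<Longrightarrow> n > 0 \<Longrightarrow> norm (\<xi> :: complex) = 1"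
  by (metis norm_one norm_power power_eq_1_iff less_irrefl norm_ge_zero)

lemma root_of_unity_power_dvd: "\<xi> ^ n = 1 \<Longrightarrow> n dvd m \<Longrightarrow> (\<xi> :: complex) ^ m = 1"
  by (auto elim!: dvdE simp: power_mult)

lemma monomial_act:
  assumes "\<xi> ^ n = 1" "(q * a + b) mod n = 0"
  shows "fst (act q \<xi> u) ^ a * snd (act q \<xi> u) ^ b = fst u ^ a * snd u ^ b"
proof -
  have "fst (act q \<xi> u) ^ a * snd (act q \<xi> u) ^ b = \<xi> ^ (q * a + b) * (fst u ^ a * snd u ^ b)"
    by (simp add: act_def power_mult_distrib power_add power_mult)
  then show ?thesis
    using root_of_unity_power_dvd[OF assms(1)] assms(2) by (simp add: mod_eq_0_iff_dvd)
qed

lemma embed_act: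
  assumes "\<xi> ^ n = 1"
  shows "embed n q (act q \<xi> u) = embed n q u"
proof (rule nth_equalityI)
  fix i assume "i < length (embed n q (act q \<xi> u))"
  then have i: "i < length (mons n q)" by simp
  obtain a b where "mons n q ! i = (a, b)" "(q * a + b) mod n = 0" using nth_mons[OF i] by metis
  then show "embed n q (act q \<xi> u) ! i = embed n q u ! i"
    using i monomial_act[OF assms] by (simp add: nth_embed)
qed simp

lemma continuous_on_act [continuous_intros]: "continuous_on A (act q \<xi>)"
  unfolding act_def by (intro continuous_intros)

lemma continuous_on_coords [continuous_intros]: "continuous_on A (coords n q)"
  unfolding coords_def by (intro continuous_intros)

context
  fixes n q :: nat
  assumes n: "n \<ge> 2" and q0: "0 < q" and qn: "q < n" and cop: "coprime q n"
begin

lemma root_of_unity_coprime: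
  assumes "\<xi> ^ n = 1" "\<xi> ^ q = (1 :: complex)"
  shows "\<xi> = 1"
proof -
  obtain x y where "q * x = n * y + 1"
    using cop q0 bezout_nat[of q n] by auto
  then have "\<xi> ^ (q * x) = \<xi> ^ (n * y + 1)" by simp
  then show ?thesis using assms by (simp add: power_mult power_add)
qed

lemma root_of_unity_qth_root:
  assumes "\<zeta> ^ n = (1 :: complex)"
  obtains \<xi> where "\<xi> ^ n = 1" "\<xi> ^ q = \<zeta>"
proof -
  obtain x y where xy: "q * x = n * y + 1"
    using cop q0 bezout_nat[of q n] by auto
  have "(\<zeta> ^ x) ^ n = 1" using assms by (metis mult.commute power_mult power_one)
  have "(\<zeta> ^ x) ^ q = \<zeta> ^ (n * y + 1)" unfolding xy[symmetric] by (metis mult.commute power_mult)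
  then have "(\<zeta> ^ x) ^ q = \<zeta>" using assms by (simp add: power_mult power_add)
  then show ?thesis using that \<open>(\<zeta> ^ x) ^ n = 1\<close> by blast
qed

text \<open>Off the axis \<open>snd u = 0\<close> the second coordinate already determines \<xi>. On
  the axis only \<open>\<xi> ^ q\<close> is visible, and coprimality recovers \<xi> from it.\<close>

lemma act_free:
  assumes "u \<noteq> 0" "\<xi> ^ n = 1" "act q \<xi> u = u"
  shows "\<xi> = 1"
proof (cases "snd u = 0")
  case True
  then have "fst u \<noteq> 0" using assms(1) by (auto simp: prod_eq_iff)
  then have "\<xi> ^ q = 1" using assms(3) by (auto simp: act_def prod_eq_iff)
  then show ?thesis using root_of_unity_coprime assms(2) by blast
next
  case False
  then show ?thesis using assms(3) by (auto simp: act_def prod_eq_iff)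
qed

lemma coords_act: "\<xi> ^ n = 1 \<Longrightarrow> coords n q (act q \<xi> u) = coords n q u"
  using monomial_act[of \<xi> n q n 0 u] monomial_act[of \<xi> n q 0 n u] monomial_act[of \<xi> n q 1 "n - q" u]
    qn by (simp add: coords_def)

text \<open>Off the axis \<open>snd u = 0\<close> the group element is the quotient of the second
  coordinates, and the mixed monomial forces the first coordinates to match. On the axis the mixed
  monomial vanishes; there the quotient of the first coordinates has a q-th root among the n-th
  roots of unity.\<close>

lemma coords_eq_imp_act:
  assumes "coords n q u = coords n q v"
  obtains \<xi> where "\<xi> ^ n = 1" "v = act q \<xi> u"
proof -
  have e: "fst u ^ n = fst v ^ n" "snd u ^ n = snd v ^ n" "fst u * snd u ^ (n - q) = fst v * snd v ^ (n - q)"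
    using assms by (auto simp: coords_def)
  show ?thesis
  proof (cases "snd u = 0")
    case False
    define \<xi> where "\<xi> = snd v / snd u"
    have "snd v ^ n \<noteq> 0" using e(2) False by (metis power_eq_0_iff)
    then have \<xi>: "\<xi> ^ n = 1" using e(2) by (simp add: \<xi>_def power_divide)
    have sv: "snd v = \<xi> * snd u" using False by (simp add: \<xi>_def)
    have "fst u * snd u ^ (n - q) = fst v * \<xi> ^ (n - q) * snd u ^ (n - q)"
      using e(3) by (simp add: sv power_mult_distrib mult.assoc)
    then have "fst u = fst v * \<xi> ^ (n - q)" using False by simp
    \<comment> \<open>Multiplying by \<open>\<xi> ^ q\<close> completes the exponent n - q to n,
      where the power of \<xi> is 1.\<close>
    then have "\<xi> ^ q * fst u = fst v * \<xi> ^ (n - q + q)" by (simp add: power_add algebra_simps)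
    then have "fst v = \<xi> ^ q * fst u" using \<xi> qn by simp
    then show ?thesis using that[OF \<xi>] sv by (simp add: act_def prod_eq_iff)
  next
    case True
    then have "snd v ^ n = 0" using e(2) n by (simp add: power_0_left)
    then have sv: "snd v = 0" by simp
    show ?thesis
    proof (cases "fst u = 0")
      case u0: True
      then have "fst v ^ n = 0" using e(1) n by (simp add: power_0_left)
      then have "fst v = 0" by simp
      then show ?thesis using that[of 1] True sv u0 by (simp add: prod_eq_iff)
    next
      case False
      then have "fst v ^ n \<noteq> 0" using e(1) by (metis power_eq_0_iff)
      then have "(fst v / fst u) ^ n = 1" using e(1) by (simp add: power_divide)
      then obtain \<xi> where "\<xi> ^ n = 1" "\<xi> ^ q = fst v / fst u" using root_of_unity_qth_root by blast
      then show ?thesis using that[of \<xi>] True sv False by (simp add: act_def prod_eq_iff)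
    qed
  qed
qed

text \<open>This is properness in quantitative form: sequences with bounded image are bounded. The 1
  covers coordinates of modulus below 1, which exceed their n-th powers.\<close>

lemma norm_le_coords: "norm u \<le> 2 * (1 + norm (coords n q u))"
proof -
  have *: "norm z \<le> 1 + norm (z ^ n)" for z :: complex
  proof (cases "norm z \<le> 1")
    case False
    then show ?thesis using self_le_power[of "norm z" n] n by (simp add: norm_power)
  qed (use norm_ge_zero[of "z ^ n"] in linarith)
  have "norm (fst u ^ n) \<le> norm (coords n q u)" "norm (snd u ^ n) \<le> norm (coords n q u)"
    using norm_fst_le[of "fst u ^ n" "(snd u ^ n, fst u * snd u ^ (n - q))"]
      norm_snd_le[of "(snd u ^ n, fst u * snd u ^ (n - q))" "fst u ^ n"]
      norm_fst_le[of "snd u ^ n" "fst u * snd u ^ (n - q)"]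
    by (auto simp: coords_def)
  then show ?thesis
    using *[of "fst u"] *[of "snd u"] norm_Pair_le[of "fst u" "snd u"] by simp
qed

text \<open>A compactness argument in place of estimates for roots. A sequence of counterexamples is
  bounded by properness; its limit has the same image as u, hence lies in the orbit of u, and the
  isometry carrying the limit to u brings late terms close to u.\<close>

lemma coords_near:
  assumes e: "e > 0"
  obtains d where "d > 0"
    "\<And>v. dist (coords n q v) (coords n q u) < d \<Longrightarrow> \<exists>\<xi>. \<xi> ^ n = 1 \<and> dist (act q \<xi> v) u < e"
proof -
  have "\<exists>d>0. \<forall>v. dist (coords n q v) (coords n q u) < d \<longrightarrow> (\<exists>\<xi>. \<xi> ^ n = 1 \<and> dist (act q \<xi> v) u < e)"
  proof (rule ccontr)
    assume "\<not> ?thesis"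
    then have "\<forall>k. \<exists>v. dist (coords n q v) (coords n q u) < inverse (Suc k)
        \<and> (\<forall>\<xi>. \<xi> ^ n = 1 \<longrightarrow> \<not> dist (act q \<xi> v) u < e)"
      by (metis inverse_positive_iff_positive of_nat_0_less_iff zero_less_Suc)
    then obtain v where v: "\<And>k. dist (coords n q (v k)) (coords n q u) < inverse (real (Suc k))"
      "\<And>k \<xi>. \<xi> ^ n = 1 \<Longrightarrow> \<not> dist (act q \<xi> (v k)) u < e" by metis
    have lim: "(\<lambda>k. coords n q (v k)) \<longlonglongrightarrow> coords n q u"
      using v(1) by (intro metric_tendsto_imp_tendsto[OF LIMSEQ_inverse_real_of_nat])
        (auto intro!: always_eventually less_imp_le simp: dist_norm)
    have "norm (v k) \<le> 2 * (1 + (norm (coords n q u) + 1))" for k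
    proof -
      have "inverse (real (Suc k)) \<le> 1" by (simp add: inverse_le_1_iff)
      then have "norm (coords n q (v k)) \<le> norm (coords n q u) + 1"
        using v(1)[of k] norm_triangle_ineq2[of "coords n q (v k)" "coords n q u"]
        unfolding dist_norm by linarith
      then show ?thesis by (intro order_trans[OF norm_le_coords]) simp
    qed
    then have "bounded (range v)" unfolding bounded_iff by blast
    then obtain l r where l: "strict_mono r" "(v \<circ> r) \<longlonglongrightarrow> l"
      using bounded_imp_convergent_subsequence by blast
    have "isCont (coords n q) l"
      by (metis UNIV_I continuous_on_coords continuous_on_eq_continuous_at open_UNIV)
    then have "(\<lambda>k. coords n q ((v \<circ> r) k)) \<longlonglongrightarrow> coords n q l" using l(2) isCont_tendsto_compose by blast
    moreover have "(\<lambda>k. coords n q ((v \<circ> r) k)) \<longlonglongrightarrow> coords n q u"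
      using LIMSEQ_subseq_LIMSEQ[OF lim l(1)] by (simp add: o_def)
    ultimately have "coords n q l = coords n q u" using LIMSEQ_unique by blast
    then obtain \<xi> where \<xi>: "\<xi> ^ n = 1" "u = act q \<xi> l" using coords_eq_imp_act by blast
    obtain N where "dist ((v \<circ> r) N) l < e"
      using l(2) e unfolding lim_sequentially by blast
    then have "dist (act q \<xi> (v (r N))) u < e"
      using dist_act[of \<xi>] norm_root_of_unity[OF \<xi>(1)] n \<xi>(2) by simp
    then show False using v(2) \<xi>(1) by blast
  qed
  then show ?thesis using that by blast
qed

text \<open>Near the image of u, every image point has a representative near u, and
  \<open>coords\<close> does not distinguish representatives.\<close>

lemma coords_open_map:
  assumes "open W" "0 \<notin> W"
  shows "openin (top_of_set (coords n q ` (- {0}))) (coords n q ` W)"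
  unfolding openin_euclidean_subtopology_iff
proof (intro conjI ballI)
  show "coords n q ` W \<subseteq> coords n q ` (- {0})" using assms by auto
  fix x assume "x \<in> coords n q ` W"
  then obtain u where u: "u \<in> W" "x = coords n q u" by blast
  then obtain e where e: "e > 0" "\<And>v. dist v u < e \<Longrightarrow> v \<in> W" using assms(1) open_dist by metis
  obtain d where d: "d > 0"
    "\<And>v. dist (coords n q v) (coords n q u) < d \<Longrightarrow> \<exists>\<xi>. \<xi> ^ n = 1 \<and> dist (act q \<xi> v) u < e"
    using coords_near[OF e(1), of u] by blast
  have "x' \<in> coords n q ` W" if x': "x' \<in> coords n q ` (- {0})" "dist x' x < d" for x'
  proof -
    obtain v where "x' = coords n q v" using x' by blast
    then show ?thesis using d(2)[of v] e(2) x'(2) u(2) coords_act by (metis imageI)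
  qed
  then show "\<exists>d>0. \<forall>x'\<in>coords n q ` (- {0}). dist x' x < d \<longrightarrow> x' \<in> coords n q ` W"
    using d(1) by blast
qed

lemma small_ball_act:
  assumes u: "u \<noteq> 0"
  obtains e where "e > 0" "0 \<notin> ball u e"
    "\<And>v \<xi>. \<lbrakk>\<xi> ^ n = 1; v \<in> ball u e; act q \<xi> v \<in> ball u e\<rbrakk> \<Longrightarrow> \<xi> = 1"
proof -
  have "finite {\<xi>::complex. \<xi> ^ n = 1}" using n by (intro finite_roots_unity) simp
  then obtain d where d: "d > 0"
    "\<And>w. w \<in> (\<lambda>\<xi>. act q \<xi> u) ` {\<xi>. \<xi> ^ n = 1} \<Longrightarrow> w \<noteq> u \<Longrightarrow> d \<le> dist u w"
    using finite_set_avoid[of "(\<lambda>\<xi>. act q \<xi> u) ` {\<xi>. \<xi> ^ n = 1}" u] by (metis finite_imageI)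
  \<comment> \<open>Half the gap \<open>d\<close> to the other orbit points separates the
    translates, as the action is isometric; \<open>norm u\<close> excludes the origin.\<close>
  define e where "e = min (d / 2) (norm u)"
  show ?thesis
  proof (rule that[of e])
    show "e > 0" "0 \<notin> ball u e" using d(1) u by (auto simp: e_def)
    fix v \<xi> assume \<xi>: "\<xi> ^ n = 1" and v: "v \<in> ball u e" "act q \<xi> v \<in> ball u e"
    have "dist u (act q \<xi> u) \<le> dist u (act q \<xi> v) + dist (act q \<xi> v) (act q \<xi> u)"
      by (rule dist_triangle)
    also have "dist (act q \<xi> v) (act q \<xi> u) = dist u v"
      using dist_act[of \<xi>] norm_root_of_unity[OF \<xi>] n by (simp add: dist_commute)
    also have "dist u (act q \<xi> v) + dist u v < d"
      using v by (auto simp: e_def)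
    finally have "act q \<xi> u = u" using d(2)[of "act q \<xi> u"] \<xi> by force
    then show "\<xi> = 1" using act_free u \<xi> by blast
  qed
qed

text \<open>The usual argument for a free action of a finite group: the translates of a small ball
  are the disjoint sheets over its image, and on each of them the open map is injective.\<close>

lemma covering_space_coords: "covering_space (- {0}) (coords n q) (coords n q ` (- {0}))"
proof
  show "continuous_on (- {0}) (coords n q)" by (intro continuous_intros)
  fix x assume "x \<in> coords n q ` (- {0})"
  then obtain u where u: "u \<noteq> 0" "x = coords n q u" by blast
  obtain e where e: "e > 0" "0 \<notin> ball u e"
    and sep: "\<And>v \<xi>. \<lbrakk>\<xi> ^ n = 1; v \<in> ball u e; act q \<xi> v \<in> ball u e\<rbrakk> \<Longrightarrow> \<xi> = 1"
    using small_ball_act[OF u(1)] by blast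
  define B where "B = ball u e"
  define R where "R = {\<xi>::complex. \<xi> ^ n = 1}"
  define T where "T = coords n q ` B"
  have R0: "\<xi> \<noteq> 0" "norm \<xi> = 1" if "\<xi> \<in> R" for \<xi>
    using that n norm_root_of_unity[of \<xi> n] by (auto simp: R_def)
  have Rinv: "inverse \<xi> \<in> R" if "\<xi> \<in> R" for \<xi> using that by (simp add: R_def power_inverse)
  have Rmul: "\<xi> * \<zeta> \<in> R" if "\<xi> \<in> R" "\<zeta> \<in> R" for \<xi> \<zeta>
    using that by (simp add: R_def power_mult_distrib)
  \<comment> \<open>As a preimage under a continuous map, a translate of the ball is visibly
    open.\<close>
  have sheet_eq: "act q \<xi> ` B = act q (inverse \<xi>) -` B" if "\<xi> \<in> R" for \<xi>
  proof
    show "act q \<xi> ` B \<subseteq> act q (inverse \<xi>) -` B" using R0 that by (auto simp: act_act)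
    show "act q (inverse \<xi>) -` B \<subseteq> act q \<xi> ` B"
    proof
      fix w assume "w \<in> act q (inverse \<xi>) -` B"
      then have "act q \<xi> (act q (inverse \<xi>) w) \<in> act q \<xi> ` B" by blast
      then show "w \<in> act q \<xi> ` B" using R0[OF that] by (simp add: act_act)
    qed
  qed
  have sheet_open: "open (act q \<xi> ` B)" if "\<xi> \<in> R" for \<xi>
    unfolding sheet_eq[OF that] by (intro open_vimage continuous_intros) (simp add: B_def)
  have sheet_0: "0 \<notin> act q \<xi> ` B" if "\<xi> \<in> R" for \<xi>
    using act_eq_0_iff[of \<xi>] R0[OF that] e(2) by (metis B_def imageE)
  have same: "\<xi> = \<zeta>" if "\<xi> \<in> R" "\<zeta> \<in> R" "b \<in> B" "b' \<in> B" "act q \<xi> b = act q \<zeta> b'" for \<xi> \<zeta> b b'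
  proof -
    have "act q (inverse \<zeta>) (act q \<xi> b) = b'" unfolding that(5) using R0[OF that(2)] by (simp add: act_act)
    then have b': "act q (inverse \<zeta> * \<xi>) b = b'" by (simp add: act_act)
    have "inverse \<zeta> * \<xi> = 1"
    proof (rule sep)
      show "(inverse \<zeta> * \<xi>) ^ n = 1" using Rmul[OF Rinv] that by (auto simp: R_def)
    qed (use b' that in \<open>auto simp: B_def\<close>)
    then show ?thesis using R0[OF that(2)] by (simp add: field_simps)
  qed
  have homeo: "\<exists>g. homeomorphism (act q \<xi> ` B) T (coords n q) g" if \<xi>: "\<xi> \<in> R" for \<xi>
  proof -
    have im: "coords n q ` act q \<xi> ` B = T"
      using \<xi> coords_act by (auto simp: T_def R_def image_image)
    have inj: "inj_on (coords n q) (act q \<xi> ` B)"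
    proof (rule inj_onI)
      fix a b assume ab: "a \<in> act q \<xi> ` B" "b \<in> act q \<xi> ` B" "coords n q a = coords n q b"
      then obtain \<zeta> where \<zeta>: "\<zeta> ^ n = 1" "b = act q \<zeta> a" using coords_eq_imp_act by blast
      obtain a' b' where "a' \<in> B" "b' \<in> B" "a = act q \<xi> a'" "b = act q \<xi> b'" using ab by blast
      then have "\<zeta> * \<xi> = \<xi>"
        using same[of "\<zeta> * \<xi>" \<xi> a' b'] \<zeta> \<xi> Rmul[of \<zeta> \<xi>] by (simp add: act_act R_def)
      then show "a = b" using R0[OF \<xi>] \<zeta> by simp
    qed
    have "openin (top_of_set T) (coords n q ` U)" if U: "openin (top_of_set (act q \<xi> ` B)) U" for U
    proof -
      have "open U" "U \<subseteq> act q \<xi> ` B" using U sheet_open[OF \<xi>] by (auto simp: openin_open_eq)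
      then have "openin (top_of_set (coords n q ` (- {0}))) (coords n q ` U)"
        using coords_open_map sheet_0[OF \<xi>] by blast
      moreover have "coords n q ` U \<subseteq> T" using \<open>U \<subseteq> _\<close> im by blast
      moreover have "T \<subseteq> coords n q ` (- {0})" using e(2) by (auto simp: T_def B_def)
      ultimately show ?thesis using openin_subset_trans by blast
    qed
    then show ?thesis
      using homeomorphism_injective_open_map[OF _ im inj] continuous_on_coords by metis
  qed
  have Un: "\<Union> ((\<lambda>\<xi>. act q \<xi> ` B) ` R) = - {0} \<inter> coords n q -` T"
  proof
    show "\<Union> ((\<lambda>\<xi>. act q \<xi> ` B) ` R) \<subseteq> - {0} \<inter> coords n q -` T"
    proof
      fix w assume "w \<in> \<Union> ((\<lambda>\<xi>. act q \<xi> ` B) ` R)"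
      then obtain \<xi> b where "\<xi> \<in> R" "b \<in> B" "w = act q \<xi> b" by blast
      then show "w \<in> - {0} \<inter> coords n q -` T"
        using sheet_0[of \<xi>] coords_act[of \<xi> b] by (auto simp: T_def R_def)
    qed
    show "- {0} \<inter> coords n q -` T \<subseteq> \<Union> ((\<lambda>\<xi>. act q \<xi> ` B) ` R)"
    proof
      fix w assume "w \<in> - {0} \<inter> coords n q -` T"
      then obtain b where "b \<in> B" "coords n q b = coords n q w" by (auto simp: T_def)
      then obtain \<xi> where "\<xi> ^ n = 1" "w = act q \<xi> b" using coords_eq_imp_act by blast
      then show "w \<in> \<Union> ((\<lambda>\<xi>. act q \<xi> ` B) ` R)"
        using \<open>b \<in> B\<close> by (auto simp: R_def)
    qed
  qed
  show "\<exists>T. x \<in> T \<and> openin (top_of_set (coords n q ` (- {0}))) T \<and>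
      (\<exists>v. \<Union> v = - {0} \<inter> coords n q -` T \<and> (\<forall>u\<in>v. openin (top_of_set (- {0})) u) \<and>
        pairwise disjnt v \<and> (\<forall>u\<in>v. \<exists>g. homeomorphism u T (coords n q) g))"
  proof (intro exI[of _ T] conjI exI[of _ "(\<lambda>\<xi>. act q \<xi> ` B) ` R"])
    show "x \<in> T" using u e(1) by (auto simp: T_def B_def)
    show "openin (top_of_set (coords n q ` (- {0}))) T"
      using coords_open_map[of B] e(2) by (auto simp: T_def B_def)
    show "\<Union> ((\<lambda>\<xi>. act q \<xi> ` B) ` R) = - {0} \<inter> coords n q -` T" by (rule Un)
    show "\<forall>u\<in>(\<lambda>\<xi>. act q \<xi> ` B) ` R. openin (top_of_set (- {0})) u"
      using sheet_open sheet_0 by (simp add: openin_open_eq open_Compl)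
    show "pairwise disjnt ((\<lambda>\<xi>. act q \<xi> ` B) ` R)"
      unfolding pairwise_def disjnt_def
    proof (intro ballI impI)
      fix X Y assume "X \<in> (\<lambda>\<xi>. act q \<xi> ` B) ` R" "Y \<in> (\<lambda>\<xi>. act q \<xi> ` B) ` R" "X \<noteq> Y"
      then obtain \<xi> \<zeta> where XY: "\<xi> \<in> R" "\<zeta> \<in> R" "X = act q \<xi> ` B" "Y = act q \<zeta> ` B" "\<xi> \<noteq> \<zeta>"
        by blast
      have "act q \<xi> b \<noteq> act q \<zeta> b'" if "b \<in> B" "b' \<in> B" for b b'
        using same[OF XY(1,2) that] XY(5) by blast
      then show "X \<inter> Y = {}" unfolding XY(3,4) by blast
    qed
    show "\<forall>u\<in>(\<lambda>\<xi>. act q \<xi> ` B) ` R. \<exists>g. homeomorphism u T (coords n q) g"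
      using homeo by blast
  qed
qed simp

text \<open>The covering gives a local inverse at w. Shrinking its domain forces the values into a
  prescribed ball, where the radial projection to the link is under control.\<close>

lemma local_section_coords:
  assumes w: "w \<noteq> 0" and e: "e > 0"
  obtains d \<sigma> where "d > 0" "continuous_on (coords n q ` (- {0}) \<inter> ball (coords n q w) d) \<sigma>"
    "\<And>x. x \<in> coords n q ` (- {0}) \<inter> ball (coords n q w) d \<Longrightarrow> \<sigma> x \<in> ball w e \<and> coords n q (\<sigma> x) = x"
proof -
  let ?S = "coords n q ` (- {0})"
  obtain T U \<sigma> where T: "w \<in> T" "openin (top_of_set (- {0})) T" "homeomorphism T U (coords n q) \<sigma>"
    and U: "openin (top_of_set ?S) U"
    using covering_space_local_homeomorphism[OF covering_space_coords, of w] w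
    by (metis ComplI singletonD)
  have "open T" "0 \<notin> T" using T(2) by (auto simp: openin_open_eq open_Compl)
  then have "openin (top_of_set ?S) (coords n q ` (T \<inter> ball w e))"
    by (intro coords_open_map) auto
  moreover have "coords n q w \<in> coords n q ` (T \<inter> ball w e)" using T e by auto
  ultimately have "\<exists>d>0. \<forall>x\<in>?S. dist x (coords n q w) < d \<longrightarrow> x \<in> coords n q ` (T \<inter> ball w e)"
    by (meson openin_euclidean_subtopology_iff)
  then obtain d where d: "d > 0"
    "\<And>x. x \<in> ?S \<Longrightarrow> dist x (coords n q w) < d \<Longrightarrow> x \<in> coords n q ` (T \<inter> ball w e)" by blast
  have sub: "?S \<inter> ball (coords n q w) d \<subseteq> coords n q ` (T \<inter> ball w e)"
  proof
    fix x assume "x \<in> ?S \<inter> ball (coords n q w) d"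
    then show "x \<in> coords n q ` (T \<inter> ball w e)" using d(2)[of x] by (simp add: dist_commute)
  qed
  show ?thesis
  proof (rule that[of d \<sigma>])
    show "continuous_on (?S \<inter> ball (coords n q w) d) \<sigma>"
    proof (rule continuous_on_subset)
      show "continuous_on U \<sigma>" using T(3) by (simp add: homeomorphism_def)
      show "?S \<inter> ball (coords n q w) d \<subseteq> U" using T(3) sub by (auto simp: homeomorphism_def)
    qed
    fix x assume "x \<in> ?S \<inter> ball (coords n q w) d"
    then obtain v where "v \<in> T" "v \<in> ball w e" "x = coords n q v" using sub by blast
    then show "\<sigma> x \<in> ball w e \<and> coords n q (\<sigma> x) = x"
      using T(3) by (auto simp: homeomorphism_def)
  qed (use d in auto)
qed

text \<open>The map \<kappa> reads three entries of the list and so carries \<open>cdist\<close>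
  estimates to the target of the covering. The factor 3 adds up the three entries.\<close>

lemma obtain_list_coords:
  obtains \<kappa> where "\<And>u. \<kappa> (embed n q u) = coords n q u"
    "\<And>x y. \<lbrakk>x \<in> quotV n q; y \<in> quotV n q\<rbrakk> \<Longrightarrow> dist (\<kappa> x) (\<kappa> y) \<le> 3 * cdist x y"
proof -
  have "(n, 0) \<in> set (mons n q)" "(0, n) \<in> set (mons n q)" "(1, n - q) \<in> set (mons n q)"
    using n q0 qn by (auto simp: mons_iff)
  then obtain i j k where ijk: "i < length (mons n q)" "mons n q ! i = (n, 0)"
    "j < length (mons n q)" "mons n q ! j = (0, n)" "k < length (mons n q)" "mons n q ! k = (1, n - q)"
    by (metis in_set_conv_nth)
  define \<kappa> where "\<kappa> x = (x ! i, x ! j, x ! k)" for x :: "complex list"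
  show ?thesis
  proof (rule that[of \<kappa>])
    show "\<kappa> (embed n q u) = coords n q u" for u
      using ijk by (simp add: \<kappa>_def coords_def nth_embed)
    fix x y assume "x \<in> quotV n q" "y \<in> quotV n q"
    then have "length x = length (mons n q)" using length_quotV by blast
    then have "dist (x ! l) (y ! l) \<le> cdist x y" if "l \<in> {i, j, k}" for l
      using nth_le_cdist[of l x y] ijk that by (auto simp: dist_norm)
    moreover have "dist (\<kappa> x) (\<kappa> y) \<le> dist (x ! i) (y ! i) + (dist (x ! j) (y ! j) + dist (x ! k) (y ! k))"
      unfolding \<kappa>_def dist_norm
      using norm_Pair_le[of "x ! i - y ! i" "(x ! j - y ! j, x ! k - y ! k)"]
        norm_Pair_le[of "x ! j - y ! j" "x ! k - y ! k"] by simp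
    ultimately show "dist (\<kappa> x) (\<kappa> y) \<le> 3 * cdist x y"
      by (smt (verit, best) insertI1 insertI2)
  qed
qed

end

section \<open>Radial projection onto the link\<close>

text \<open>Boundedness is carried along because it is what makes Lipschitz functions stable under
  products.\<close>

definition lipschitz_bounded :: "('a::metric_space) set \<Rightarrow> ('a \<Rightarrow> 'b::real_normed_algebra_1) \<Rightarrow> bool" where
  "lipschitz_bounded A f \<longleftrightarrow> bounded (f ` A) \<and> (\<exists>L. L-lipschitz_on A f)"

lemma lipschitz_bounded_mult:
  assumes "lipschitz_bounded A f" "lipschitz_bounded A g"
  shows "lipschitz_bounded A (\<lambda>x. f x * g x)"
proof -
  obtain B1 B2 where B: "\<And>x. x \<in> A \<Longrightarrow> norm (f x) \<le> B1" "\<And>x. x \<in> A \<Longrightarrow> norm (g x) \<le> B2"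
    using assms unfolding lipschitz_bounded_def bounded_iff by (metis imageI)
  obtain L1 L2 where L: "L1-lipschitz_on A f" "L2-lipschitz_on A g"
    using assms unfolding lipschitz_bounded_def by blast
  have "norm (f x * g x) \<le> \<bar>B1\<bar> * \<bar>B2\<bar>" if "x \<in> A" for x
    using B[OF that] by (intro order_trans[OF norm_mult_ineq] mult_mono) auto
  then have "bounded ((\<lambda>x. f x * g x) ` A)" unfolding bounded_iff by blast
  moreover have "(\<bar>B1\<bar> * L2 + L1 * \<bar>B2\<bar>)-lipschitz_on A (\<lambda>x. f x * g x)"
  proof (rule lipschitz_onI)
    fix x y assume xy: "x \<in> A" "y \<in> A"
    have "f x * g x - f y * g y = f x * (g x - g y) + (f x - f y) * g y" by (simp add: algebra_simps)
    then have "dist (f x * g x) (f y * g y) \<le> norm (f x * (g x - g y)) + norm ((f x - f y) * g y)"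
      by (metis dist_norm norm_triangle_ineq)
    also have "\<dots> \<le> norm (f x) * dist (g x) (g y) + dist (f x) (f y) * norm (g y)"
      unfolding dist_norm by (intro add_mono norm_mult_ineq)
    also have "\<dots> \<le> \<bar>B1\<bar> * (L2 * dist x y) + (L1 * dist x y) * \<bar>B2\<bar>"
      using B[OF xy(1)] B[OF xy(2)] lipschitz_onD[OF L(1) xy] lipschitz_onD[OF L(2) xy]
        lipschitz_on_nonneg[OF L(1)]
      by (intro add_mono mult_mono) auto
    finally show "dist (f x * g x) (f y * g y) \<le> (\<bar>B1\<bar> * L2 + L1 * \<bar>B2\<bar>) * dist x y"
      by (simp add: algebra_simps)
  qed (use lipschitz_on_nonneg[OF L(1)] lipschitz_on_nonneg[OF L(2)] in simp)
  ultimately show ?thesis unfolding lipschitz_bounded_def by blast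
qed

lemma lipschitz_bounded_power: "lipschitz_bounded A f \<Longrightarrow> lipschitz_bounded A (\<lambda>x. f x ^ k)"
proof (induction k)
  case 0
  have "bounded ((\<lambda>x::'a. 1 :: 'b) ` A)" unfolding bounded_iff by (intro exI[of _ 1]) auto
  then show ?case
    unfolding lipschitz_bounded_def power_0 using lipschitz_on_constant by blast
qed (simp add: lipschitz_bounded_mult)

lemma lipschitz_bounded_fst: "bounded A \<Longrightarrow> lipschitz_bounded A fst"
  unfolding lipschitz_bounded_def
  by (intro conjI exI[of _ 1] lipschitz_onI bounded_fst) (simp_all add: dist_fst_le)

lemma lipschitz_bounded_snd: "bounded A \<Longrightarrow> lipschitz_bounded A snd"
  unfolding lipschitz_bounded_def
  by (intro conjI exI[of _ 1] lipschitz_onI bounded_snd) (simp_all add: dist_snd_le)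

lemma embed_lipschitz:
  obtains L where "L \<ge> 0" "\<And>u v. \<lbrakk>norm u \<le> R; norm v \<le> R\<rbrakk> \<Longrightarrow> cdist (embed n q u) (embed n q v) \<le> L * dist u v"
proof -
  let ?A = "cball (0 :: complex \<times> complex) R"
  have ex: "\<exists>L. L-lipschitz_on ?A (\<lambda>u. fst u ^ a * snd u ^ b)" for a b
    using lipschitz_bounded_mult[OF lipschitz_bounded_power lipschitz_bounded_power,
        OF lipschitz_bounded_fst lipschitz_bounded_snd, of ?A a b]
    unfolding lipschitz_bounded_def by simp
  define L where "L a b = (SOME L. L-lipschitz_on ?A (\<lambda>u. fst u ^ a * snd u ^ b))" for a b
  have L: "(L a b)-lipschitz_on ?A (\<lambda>u. fst u ^ a * snd u ^ b)" for a b
    unfolding L_def by (rule someI_ex[OF ex])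
  \<comment> \<open>The sum of the nonnegative Lipschitz constants dominates each of them.\<close>
  define L0 where "L0 = (\<Sum>(a, b)\<in>set (mons n q). L a b)"
  have L0: "0 \<le> L a b" for a b using L lipschitz_on_nonneg by blast
  show ?thesis
  proof (rule that[of "real (length (mons n q)) * L0"])
    show "0 \<le> real (length (mons n q)) * L0" using L0 by (auto simp: L0_def intro!: sum_nonneg mult_nonneg_nonneg)
    fix u v :: "complex \<times> complex" assume uv: "norm u \<le> R" "norm v \<le> R"
    have "cdist (embed n q u) (embed n q v) \<le> real (length (embed n q u)) * (L0 * dist u v)"
    proof (rule cdist_le_length_mult)
      fix i assume "i < length (embed n q u)"
      then have i: "i < length (mons n q)" by simp
      obtain a b where ab: "mons n q ! i = (a, b)" by fastforce
      then have "(a, b) \<in> set (mons n q)" using i nth_mem by metis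
      then have "L a b \<le> L0"
        using L0 member_le_sum[of "(a, b)" "set (mons n q)" "\<lambda>(a, b). L a b"] by (auto simp: L0_def)
      then have "L a b * dist u v \<le> L0 * dist u v" by (intro mult_right_mono) auto
      then show "cmod (embed n q u ! i - embed n q v ! i) \<le> L0 * dist u v"
        using lipschitz_onD[OF L[of a b], of u v] uv i ab by (simp add: nth_embed dist_norm)
    qed
    then show "cdist (embed n q u) (embed n q v) \<le> real (length (mons n q)) * L0 * dist u v"
      by (simp add: mult.assoc)
  qed
qed

lemma inner_dist_le_lipschitz_segment:
  fixes u v :: "'a::real_normed_vector"
  assumes "convex A" "u \<in> A" "v \<in> A" "0 \<le> L" "G ` A \<subseteq> S"
    and lip: "\<And>x y. \<lbrakk>x \<in> A; y \<in> A\<rbrakk> \<Longrightarrow> cdist (G x) (G y) \<le> L * dist x y"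
  shows "inner_dist S (G u) (G v) \<le> ereal (L * dist u v)"
proof (rule inner_dist_le_lipschitz[where G = "\<lambda>s. G ((1 - s) *\<^sub>R u + s *\<^sub>R v)"])
  have A: "(1 - s) *\<^sub>R u + s *\<^sub>R v \<in> A" if "s \<in> {0..1}" for s
    using assms(1-3) that by (intro convexD) auto
  then show "(\<lambda>s. G ((1 - s) *\<^sub>R u + s *\<^sub>R v)) ` {0..1} \<subseteq> S" using assms(5) by blast
  fix s s' :: real assume s: "s \<in> {0..1}" "s' \<in> {0..1}"
  have "((1 - s) *\<^sub>R u + s *\<^sub>R v) - ((1 - s') *\<^sub>R u + s' *\<^sub>R v) = (s - s') *\<^sub>R (v - u)"
    by (simp add: algebra_simps)
  then have "dist ((1 - s) *\<^sub>R u + s *\<^sub>R v) ((1 - s') *\<^sub>R u + s' *\<^sub>R v) = dist u v * \<bar>s - s'\<bar>"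
    by (simp add: dist_norm norm_minus_commute)
  then show "cdist (G ((1 - s) *\<^sub>R u + s *\<^sub>R v)) (G ((1 - s') *\<^sub>R u + s' *\<^sub>R v))
      \<le> L * dist u v * \<bar>s - s'\<bar>"
    using lip[OF A A, OF s] by (simp add: mult.assoc)
qed (use assms in auto)

text \<open>Every coordinate has degree at least 1 and hence grows at least linearly along rays. The
  degrees may differ, so this inequality takes the place of homogeneity: it makes each ray meet the
  preimage of the link exactly once.\<close>

lemma gauge_scaleR_ge:
  assumes "c \<ge> 1"
  shows "c * cnorm (embed n q u) \<le> cnorm (embed n q (c *\<^sub>R u))"
proof -
  have "c * cnorm (embed n q u) = L2_set (\<lambda>i. c * cmod (embed n q u ! i)) {..<length (mons n q)}"
    using assms by (simp add: cnorm_L2_set L2_set_right_distrib)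
  also have "\<dots> \<le> L2_set (\<lambda>i. cmod (embed n q (c *\<^sub>R u) ! i)) {..<length (mons n q)}"
  proof (rule L2_set_mono)
    fix i assume "i \<in> {..<length (mons n q)}"
    then have i: "i < length (mons n q)" by simp
    obtain a b where ab: "mons n q ! i = (a, b)" "1 \<le> a + b" using nth_mons[OF i] by metis
    have "embed n q (c *\<^sub>R u) ! i = of_real (c ^ (a + b)) * embed n q u ! i"
      using i ab by (simp add: nth_embed scaleR_conv_of_real power_mult_distrib power_add)
    then have "cmod (embed n q (c *\<^sub>R u) ! i) = c ^ (a + b) * cmod (embed n q u ! i)"
      using assms by (simp add: norm_mult norm_power)
    moreover have "c \<le> c ^ (a + b)" using assms ab by (intro self_le_power) auto
    ultimately show "c * cmod (embed n q u ! i) \<le> cmod (embed n q (c *\<^sub>R u) ! i)"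
      by (simp add: mult_right_mono)
  qed (use assms in simp)
  also have "\<dots> = cnorm (embed n q (c *\<^sub>R u))" by (simp add: cnorm_L2_set)
  finally show ?thesis .
qed

lemma cnorm_embed_diff_le: "cnorm (embed n q u) \<le> cdist (embed n q u) (embed n q v) + cnorm (embed n q v)"
  by (rule cnorm_diff_le) simp

lemma continuous_on_gauge [continuous_intros]: "continuous_on A (\<lambda>u. cnorm (embed n q u))"
proof -
  have "cnorm (embed n q u) = sqrt (\<Sum>i<length (mons n q).
      (cmod (fst u ^ fst (mons n q ! i) * snd u ^ snd (mons n q ! i)))\<^sup>2)" for u
    unfolding cnorm_L2_set L2_set_def length_embed
    by (intro arg_cong[of _ _ sqrt] sum.cong) (auto simp: nth_embed[OF _ prod.collapse[symmetric]])
  then show ?thesis by (simp only:) (intro continuous_intros)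
qed

lemma gauge_power_le:
  assumes "n \<ge> 1"
  shows "norm (fst u) ^ n \<le> cnorm (embed n q u)" "norm (snd u) ^ n \<le> cnorm (embed n q u)"
proof -
  have "(n, 0) \<in> set (mons n q)" "(0, n) \<in> set (mons n q)" using assms by (auto simp: mons_iff)
  then obtain i j where "i < length (mons n q)" "mons n q ! i = (n, 0)"
    "j < length (mons n q)" "mons n q ! j = (0, n)" by (metis in_set_conv_nth)
  then show "norm (fst u) ^ n \<le> cnorm (embed n q u)" "norm (snd u) ^ n \<le> cnorm (embed n q u)"
    using nth_le_cnorm[of i "embed n q u"] nth_le_cnorm[of j "embed n q u"]
    by (simp_all add: nth_embed norm_power)
qed

lemma gauge_pos:
  assumes "n \<ge> 1" "u \<noteq> 0"
  shows "0 < cnorm (embed n q u)"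
proof -
  have "fst u \<noteq> 0 \<or> snd u \<noteq> 0" using assms(2) by (auto simp: prod_eq_iff)
  then have "0 < norm (fst u) ^ n \<or> 0 < norm (snd u) ^ n" by auto
  then show ?thesis using gauge_power_le[OF assms(1), of u q] by linarith
qed

text \<open>The preimage of a link is bounded, which allows convergent subsequences to be extracted
  there.\<close>

lemma norm_le_gauge:
  assumes "n \<ge> 1"
  shows "norm u \<le> 2 * (1 + cnorm (embed n q u))"
proof -
  have *: "x \<le> 1 + y" if "x ^ n \<le> y" "0 \<le> x" "0 \<le> y" for x y :: real
    using self_le_power[of x n] that assms by (cases "x \<le> 1") auto
  show ?thesis
    using *[OF gauge_power_le(1)[OF assms, of u q]] *[OF gauge_power_le(2)[OF assms, of u q]]
      norm_Pair_le[of "fst u" "snd u"] by simp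
qed

lemma embed_0: "embed n q 0 = singpt n q"
  by (simp add: singpt_def zero_prod_def)

lemma obtain_gauge_scaling:
  assumes "n \<ge> 1" "u \<noteq> 0" "\<epsilon> > 0"
  obtains c where "c > 0" "cnorm (embed n q (c *\<^sub>R u)) = \<epsilon>"
proof -
  define g where "g c = cnorm (embed n q (c *\<^sub>R u))" for c
  \<comment> \<open>Linear growth pushes the gauge to level \<epsilon> or above at
    \<open>c1\<close>; the 1 makes the growth estimate applicable.\<close>
  define c1 where "c1 = max 1 (\<epsilon> / cnorm (embed n q u))"
  have pos: "0 < cnorm (embed n q u)" using gauge_pos assms by blast
  have "\<epsilon> \<le> c1 * cnorm (embed n q u)"
    using pos by (simp add: c1_def field_simps max_def)
  also have "\<dots> \<le> g c1" unfolding g_def by (rule gauge_scaleR_ge) (simp add: c1_def)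
  finally have "\<epsilon> \<le> g c1" .
  moreover have g0: "g 0 = 0" by (simp add: g_def embed_0)
  moreover have "continuous_on {0..c1} g"
    unfolding g_def
    by (rule continuous_on_compose2[OF continuous_on_gauge[of UNIV]]) (auto intro!: continuous_intros)
  moreover have "0 \<le> c1" by (simp add: c1_def)
  ultimately obtain c where c: "0 \<le> c" "g c = \<epsilon>" using IVT'[of g 0 \<epsilon> c1] assms(3) by auto
  moreover have "c \<noteq> 0" using c g0 assms(3) by auto
  ultimately show ?thesis using that[of c] by (simp add: g_def)
qed

lemma gauge_scaling_unique:
  assumes "n \<ge> 1" "u \<noteq> 0" "c > 0" "cnorm (embed n q (c *\<^sub>R u)) = cnorm (embed n q u)"
  shows "c = 1"
proof -
  have pos: "0 < cnorm (embed n q u)" using gauge_pos assms by blast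
  have "c \<le> 1"
  proof (rule ccontr)
    assume "\<not> c \<le> 1"
    then show False
      using gauge_scaleR_ge[of c n q u] assms(4) pos mult_strict_right_mono[of 1 c "cnorm (embed n q u)"]
      by simp
  qed
  moreover have "1 / c \<le> 1"
  proof (rule ccontr)
    assume "\<not> 1 / c \<le> 1"
    then show False
      using gauge_scaleR_ge[of "1 / c" n q "c *\<^sub>R u"] assms(3,4) pos
        mult_strict_right_mono[of 1 "1 / c" "cnorm (embed n q u)"]
      by simp
  qed
  ultimately show ?thesis using assms(3) by (simp add: field_simps)
qed

text \<open>\<open>\<Phi>\<close> is the radial projection onto the preimage of the link, followed by \<open>embed\<close>.\<close>

lemma obtain_radial_projection:
  assumes n: "n \<ge> 1" and \<epsilon>: "\<epsilon> > 0" and w: "0 \<notin> cball w e"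
  obtains \<Phi> L where "L \<ge> 0"
    "\<And>v. v \<in> cball w e \<Longrightarrow> \<Phi> v \<in> link n q \<epsilon>"
    "\<And>v. \<lbrakk>v \<in> cball w e; cnorm (embed n q v) = \<epsilon>\<rbrakk> \<Longrightarrow> \<Phi> v = embed n q v"
    "\<And>u v. \<lbrakk>u \<in> cball w e; v \<in> cball w e\<rbrakk>
      \<Longrightarrow> inner_dist (link n q \<epsilon>) (\<Phi> u) (\<Phi> v) \<le> ereal (L * dist u v)"
proof (cases "cball w e = {}")
  case True
  then show ?thesis using that[of 0] by auto
next
  case ne: False
  let ?K = "cball w e"
  let ?g = "\<lambda>u. cnorm (embed n q u)"
  have nz: "v \<noteq> 0" if "v \<in> ?K" for v using that w by auto
  then have "\<forall>v\<in>?K. \<exists>c>0. ?g (c *\<^sub>R v) = \<epsilon>"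
    using obtain_gauge_scaling[OF n _ \<epsilon>] by metis
  then obtain c where c: "\<And>v. v \<in> ?K \<Longrightarrow> 0 < c v" "\<And>v. v \<in> ?K \<Longrightarrow> ?g (c v *\<^sub>R v) = \<epsilon>"
    by metis
  obtain v0 where v0: "v0 \<in> ?K" "\<And>v. v \<in> ?K \<Longrightarrow> ?g v0 \<le> ?g v"
    using continuous_attains_inf[OF compact_cball ne continuous_on_gauge] by blast
  define m where "m = ?g v0"
  have m: "m > 0" using gauge_pos n nz v0(1) by (simp add: m_def)
  \<comment> \<open>If a scale factor c is at least 1, linear growth gives c m \<le> \<epsilon>, so
    \<Lambda> bounds all scale factors.\<close>
  define \<Lambda> where "\<Lambda> = max 1 (\<epsilon> / m)"
  have \<Lambda>: "1 \<le> \<Lambda>" by (simp add: \<Lambda>_def)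
  have c_le: "c v \<le> \<Lambda>" if v: "v \<in> ?K" for v
  proof (cases "1 \<le> c v")
    case True
    have "c v * m \<le> c v * ?g v" using v0(2)[OF v] c(1)[OF v] by (simp add: m_def)
    also have "\<dots> \<le> \<epsilon>" using gauge_scaleR_ge[OF True, of n q v] c(2)[OF v] by simp
    finally show ?thesis using m by (simp add: \<Lambda>_def field_simps le_max_iff_disj)
  qed (use \<Lambda> in auto)
  define R0 where "R0 = norm w + e"
  have R0: "norm v \<le> R0" if "v \<in> ?K" for v
    using that norm_triangle_ineq2[of v w] by (simp add: R0_def dist_norm norm_minus_commute)
  obtain L where L: "L \<ge> 0" "\<And>u v. \<lbrakk>norm u \<le> \<Lambda> * R0; norm v \<le> \<Lambda> * R0\<rbrakk>
      \<Longrightarrow> cdist (embed n q u) (embed n q v) \<le> L * dist u v"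
    using embed_lipschitz by metis
  have scale_R: "norm (c u *\<^sub>R v) \<le> \<Lambda> * R0" if "u \<in> ?K" "v \<in> ?K" for u v
    using c_le[OF that(1)] c(1)[OF that(1)] R0[OF that(2)] \<Lambda> by (simp add: mult_mono)
  define C where "C = \<Lambda> * L * \<Lambda> / \<epsilon>"
  have C: "0 \<le> C" using \<Lambda> L \<epsilon> by (simp add: C_def)
  \<comment> \<open>Scaling v by the smaller factor \<open>c u\<close> misses level \<epsilon> by at
    most L times c u times the distance of u and v. Since the gauge then grows at least linearly,
    the remaining factor \<open>c v / c u\<close> must be close to 1.\<close>
  have c_lip1: "c v - c u \<le> C * dist u v" if uv: "u \<in> ?K" "v \<in> ?K" "c u \<le> c v" for u v
  proof -
    have "\<epsilon> \<le> cdist (embed n q (c u *\<^sub>R u)) (embed n q (c u *\<^sub>R v)) + ?g (c u *\<^sub>R v)"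
      using cnorm_embed_diff_le[of n q "c u *\<^sub>R u" "c u *\<^sub>R v"] c(2)[OF uv(1)] by simp
    also have "\<dots> \<le> L * dist (c u *\<^sub>R u) (c u *\<^sub>R v) + ?g (c u *\<^sub>R v)"
      using L(2) scale_R uv by (intro add_right_mono) blast
    also have "dist (c u *\<^sub>R u) (c u *\<^sub>R v) = c u * dist u v"
      using c(1)[OF uv(1)] by (simp add: dist_norm flip: scaleR_diff_right)
    finally have 1: "\<epsilon> - L * (c u * dist u v) \<le> ?g (c u *\<^sub>R v)" by simp
    have "c v / c u * (\<epsilon> - L * (c u * dist u v)) \<le> c v / c u * ?g (c u *\<^sub>R v)"
      using 1 c uv by (intro mult_left_mono) (auto simp: less_imp_le)
    also have "\<dots> \<le> \<epsilon>"
    proof -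
      have "c u > 0" using c(1) uv by blast
      then have "1 \<le> c v / c u" "(c v / c u) *\<^sub>R c u *\<^sub>R v = c v *\<^sub>R v" using uv by auto
      then show ?thesis using gauge_scaleR_ge[of "c v / c u" n q "c u *\<^sub>R v"] c(2)[OF uv(2)] by metis
    qed
    finally have "c v * (\<epsilon> - L * (c u * dist u v)) \<le> \<epsilon> * c u"
      using c(1)[OF uv(1)] by (simp add: field_simps)
    then have "(c v - c u) * \<epsilon> \<le> c v * (L * (c u * dist u v))"
      by (simp add: algebra_simps)
    also have "\<dots> \<le> \<Lambda> * (L * (\<Lambda> * dist u v))"
      using c_le c(1) uv \<Lambda> L by (intro mult_mono) (auto simp: less_imp_le)
    finally show ?thesis using \<epsilon> by (simp add: C_def field_simps)
  qed
  have c_lip: "\<bar>c u - c v\<bar> \<le> C * dist u v" if uv: "u \<in> ?K" "v \<in> ?K" for u v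
    using c_lip1[OF uv] c_lip1[OF uv(2,1)] by (cases "c u \<le> c v") (auto simp: dist_commute)
  define \<Phi> where "\<Phi> v = embed n q (c v *\<^sub>R v)" for v
  define L' where "L' = L * (\<Lambda> + C * R0)"
  have "R0 \<ge> 0" using R0[OF v0(1)] norm_ge_zero order_trans by blast
  then have L': "L' \<ge> 0" using L \<Lambda> C by (simp add: L'_def)
  have \<Phi>_lip: "cdist (\<Phi> u) (\<Phi> v) \<le> L' * dist u v" if uv: "u \<in> ?K" "v \<in> ?K" for u v
  proof -
    have "c u *\<^sub>R u - c v *\<^sub>R v = (c u - c v) *\<^sub>R u + c v *\<^sub>R (u - v)" by (simp add: algebra_simps)
    then have "dist (c u *\<^sub>R u) (c v *\<^sub>R v) \<le> \<bar>c u - c v\<bar> * norm u + c v * dist u v"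
      using c(1)[OF uv(2)] norm_triangle_ineq[of "(c u - c v) *\<^sub>R u" "c v *\<^sub>R (u - v)"]
      by (simp add: dist_norm)
    also have "\<dots> \<le> C * dist u v * R0 + \<Lambda> * dist u v"
      using c_lip uv R0 c_le C \<Lambda> by (intro add_mono mult_mono) auto
    finally have "dist (c u *\<^sub>R u) (c v *\<^sub>R v) \<le> (\<Lambda> + C * R0) * dist u v" by (simp add: algebra_simps)
    then have "L * dist (c u *\<^sub>R u) (c v *\<^sub>R v) \<le> L' * dist u v"
      unfolding L'_def mult.assoc using L(1) by (intro mult_left_mono) auto
    then show ?thesis
      using L(2)[OF scale_R scale_R, of u u v v] uv unfolding \<Phi>_def by linarith
  qed
  have \<Phi>_link: "\<Phi> v \<in> link n q \<epsilon>" if "v \<in> ?K" for v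
    using c(2)[OF that] by (simp add: \<Phi>_def link_def)
  show ?thesis
  proof (rule that[OF L' \<Phi>_link])
    fix v assume v: "v \<in> ?K" "?g v = \<epsilon>"
    then have "c v = 1" using gauge_scaling_unique[OF n nz[OF v(1)] c(1)[OF v(1)]] c(2)[OF v(1)] v(2) by metis
    then show "\<Phi> v = embed n q v" by (simp add: \<Phi>_def)
  next
    fix u v assume "u \<in> ?K" "v \<in> ?K"
    then show "inner_dist (link n q \<epsilon>) (\<Phi> u) (\<Phi> v) \<le> ereal (L' * dist u v)"
      using \<Phi>_lip \<Phi>_link L' by (intro inner_dist_le_lipschitz_segment[of ?K]) auto
  qed
qed

section \<open>Fast loops\<close>

lemma norm_cis_diff_le: "norm (cis x - cis y) \<le> \<bar>x - y\<bar>"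
proof -
  have "cis x - cis y = cis y * (cis (x - y) - 1)" by (simp add: right_diff_distrib cis_mult)
  then have "norm (cis x - cis y) = norm (exp (\<i> * of_real (x - y)) - 1)"
    by (simp add: norm_mult cis_conv_exp)
  also have "\<dots> = 2 * \<bar>sin ((x - y) / 2)\<bar>" by (rule dist_exp_i_1)
  also have "\<dots> \<le> \<bar>x - y\<bar>" using abs_sin_x_le_abs_x[of "(x - y) / 2"] by simp
  finally show ?thesis .
qed

lemma cis_fraction_neq_1:
  assumes "0 < a" "a < n"
  shows "cis (- (2 * pi * real a / real n)) \<noteq> 1"
proof
  assume "cis (- (2 * pi * real a / real n)) = 1"
  then have "cos (2 * pi * real a / real n) = 1" by (simp add: complex_eq_iff)
  then obtain k :: int where "2 * pi * real a / real n = of_int k * 2 * pi"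
    using cos_one_2pi_int by blast
  then have "real a = of_int k * real n" using assms by (simp add: field_simps)
  then have k: "int a = k * int n" by (metis of_int_eq_iff of_int_mult of_int_of_nat_eq)
  have "0 < k * int n" unfolding k[symmetric] using assms by simp
  then have "0 < k" using assms by (simp add: zero_less_mult_iff)
  then have "int n \<le> int a" unfolding k using mult_right_mono[of 1 k "int n"] by simp
  then show False using assms by simp
qed

text \<open>The order in \<tau> of a monomial when |u1| = \<tau>^(n+2) and |u2| = \<tau>^(n+1). For
  exponents (a, b) it equals (n+1)(a+b) + a, which encodes degree and first exponent as digits in
  base n+1.\<close>

definition weight :: "nat \<Rightarrow> nat \<times> nat \<Rightarrow> nat" where
  "weight n m = (n + 2) * fst m + (n + 1) * snd m"

text \<open>Lexicographic minimality in (degree, first exponent) singles out one monomial, and \<open>q \<noteq> 1\<close>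
  makes it a mixed one, since the monomial with exponents \<open>(1, n - q)\<close> has degree below \<open>n\<close>.\<close>

lemma obtain_dominant_monomial:
  assumes "n \<ge> 2" "1 < q" "q < n"
  obtains a0 b0 where "(a0, b0) \<in> set (mons n q)" "0 < a0" "a0 < n"
    "\<And>m. m \<in> set (mons n q) \<Longrightarrow> m = (a0, b0) \<or> weight n (a0, b0) < weight n m"
proof -
  have m1: "(1, n - q) \<in> set (mons n q)" using assms by (auto simp: mons_iff)
  obtain m0 where m0: "m0 \<in> set (mons n q)" "\<And>m. m \<in> set (mons n q) \<Longrightarrow> weight n m0 \<le> weight n m"
  proof -
    have "mons n q \<noteq> []" using m1 by auto
    then show ?thesis
      using ex_min_if_finite[of "weight n ` set (mons n q)"] that by (auto simp: not_less)
  qed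
  obtain a0 b0 where ab: "m0 = (a0, b0)" by fastforce
  have w: "weight n (a, b) = (n + 1) * (a + b) + a" for a b
    by (simp add: weight_def algebra_simps)
  have "(n + 1) * (a0 + b0) + a0 \<le> (n + 1) * (n - q + 1) + 1"
    using m0(2)[OF m1] w ab by (simp add: add.commute)
  \<comment> \<open>Here q \<ge> 2 enters: the monomial with exponents (1, n - q) has degree at most
    n - 1.\<close>
  also have "\<dots> \<le> (n + 1) * (n - 1) + 1"
    using assms by (intro add_right_mono mult_left_mono) auto
  also have "\<dots> < (n + 1) * n" using assms by (cases n) auto
  finally have "(n + 1) * (a0 + b0) < (n + 1) * n" by linarith
  then have deg: "a0 + b0 < n" by (metis mult_less_cancel1)
  \<comment> \<open>A pure power of u2 would have its exponent divisible by n, which the degree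
    bound excludes.\<close>
  have "0 < a0"
  proof (rule ccontr)
    assume "\<not> 0 < a0"
    then show False using m0(1) deg by (auto simp: ab mons_iff dest: dvd_imp_le)
  qed
  moreover have "m = (a0, b0) \<or> weight n (a0, b0) < weight n m" if m: "m \<in> set (mons n q)" for m
  proof (rule disjCI)
    assume "\<not> weight n (a0, b0) < weight n m"
    then have eq: "weight n m = weight n (a0, b0)" using m0(2)[OF m] ab by simp
    obtain a b where m_eq: "m = (a, b)" by fastforce
    have lt: "a < n + 1" "a0 < n + 1" using m deg by (auto simp: m_eq mons_iff)
    \<comment> \<open>Division with remainder by n + 1 recovers degree and first exponent from the
      weight.\<close>
    have "(a + b) * (n + 1) + a = (a0 + b0) * (n + 1) + a0"
      using eq unfolding m_eq w by (simp only: mult.commute)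
    moreover have "(x * N + r) div N = x \<and> (x * N + r) mod N = r" if "r < N" for x r N :: nat
      using that by simp
    ultimately have "a + b = a0 + b0" "a = a0" using lt by metis+
    then show "m = (a0, b0)" by (simp add: m_eq)
  qed
  ultimately show ?thesis using that[of a0 b0] m0(1) deg ab by simp
qed

text \<open>The phases are chosen such that the dominant monomial is constant along \<open>fast_arc\<close>.\<close>

definition fast_arc :: "nat \<Rightarrow> nat \<times> nat \<Rightarrow> real \<Rightarrow> real \<Rightarrow> complex \<times> complex" where
  "fast_arc n m \<tau> \<theta> =
     (of_real (\<tau> ^ (n + 2)) * cis (2 * pi * snd m / n * \<theta>),
      of_real (\<tau> ^ (n + 1)) * cis (- (2 * pi * fst m / n * \<theta>)))"

lemma continuous_on_fast_arc: "continuous_on A (fast_arc n m \<tau>)"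
  unfolding fast_arc_def cis_conv_exp by (intro continuous_intros)

text \<open>The phase velocity is proportional to the determinant of (a, b) and \<open>m\<close>, so
  it vanishes for \<open>m\<close> itself.\<close>

lemma monomial_fast_arc:
  "fst (fast_arc n m \<tau> \<theta>) ^ a * snd (fast_arc n m \<tau> \<theta>) ^ b
    = of_real (\<tau> ^ weight n (a, b)) * cis (2 * pi * (real a * snd m - real b * fst m) / n * \<theta>)"
proof -
  have "fst (fast_arc n m \<tau> \<theta>) ^ a * snd (fast_arc n m \<tau> \<theta>) ^ b
      = of_real ((\<tau> ^ (n + 2)) ^ a * (\<tau> ^ (n + 1)) ^ b)
        * (cis (2 * pi * snd m / n * \<theta>) ^ a * cis (- (2 * pi * fst m / n * \<theta>)) ^ b)"
    by (simp add: fast_arc_def power_mult_distrib)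
  also have "(\<tau> ^ (n + 2)) ^ a * (\<tau> ^ (n + 1)) ^ b = \<tau> ^ weight n (a, b)"
    by (simp only: weight_def fst_conv snd_conv power_add power_mult)
  also have "cis (2 * pi * snd m / n * \<theta>) ^ a * cis (- (2 * pi * fst m / n * \<theta>)) ^ b
      = cis (real a * (2 * pi * snd m / n * \<theta>) + real b * (- (2 * pi * fst m / n * \<theta>)))"
    by (simp only: Complex.DeMoivre cis_mult)
  also have "real a * (2 * pi * snd m / n * \<theta>) + real b * (- (2 * pi * fst m / n * \<theta>))
      = 2 * pi * (real a * snd m - real b * fst m) / n * \<theta>"
    by (simp add: algebra_simps diff_divide_distrib)
  finally show ?thesis .
qed

lemma norm_fast_arc_le:
  assumes "0 \<le> \<tau>" "\<tau> \<le> 1"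
  shows "norm (fast_arc n m \<tau> \<theta>) \<le> 2 * \<tau>"
proof -
  have "\<tau> ^ (n + 2) \<le> \<tau>" "\<tau> ^ (n + 1) \<le> \<tau>"
    using power_decreasing[of 1 "n + 2" \<tau>] power_decreasing[of 1 "n + 1" \<tau>] assms by simp_all
  then show ?thesis
    using norm_Pair_le[of "fst (fast_arc n m \<tau> \<theta>)" "snd (fast_arc n m \<tau> \<theta>)"] assms
    by (simp add: fast_arc_def norm_mult norm_power)
qed

text \<open>The coordinate of constant modulus \<open>\<tau> ^ weight n m\<close> alone keeps the
  arc away from the singular point.\<close>

lemma cnorm_fast_arc_ge:
  assumes "m \<in> set (mons n q)" "0 \<le> \<tau>"
  shows "\<tau> ^ weight n m \<le> cnorm (embed n q (fast_arc n m \<tau> \<theta>))"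
proof -
  obtain i where i: "i < length (mons n q)" "mons n q ! i = m" using assms(1) by (metis in_set_conv_nth)
  obtain a b where ab: "m = (a, b)" by fastforce
  have "cmod (embed n q (fast_arc n m \<tau> \<theta>) ! i) = \<tau> ^ weight n m"
    unfolding nth_embed[OF i(1) i(2)[unfolded ab]] monomial_fast_arc
    using assms by (simp add: ab norm_mult norm_power)
  then show ?thesis using nth_le_cnorm[of i "embed n q (fast_arc n m \<tau> \<theta>)"] i by simp
qed

text \<open>The dominant coordinate does not move, and every other one is smaller by at least one
  factor \<tau> because weights are integers.\<close>

lemma fast_arc_speed:
  assumes m: "m \<in> set (mons n q)" and \<tau>: "0 \<le> \<tau>" "\<tau> \<le> 1" and n: "n \<ge> 1"
    and dom: "\<And>m'. m' \<in> set (mons n q) \<Longrightarrow> m' = m \<or> weight n m < weight n m'"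
  shows "cdist (embed n q (fast_arc n m \<tau> \<theta>)) (embed n q (fast_arc n m \<tau> \<theta>'))
    \<le> real (length (mons n q)) * (2 * pi * n) * \<tau> ^ (weight n m + 1) * \<bar>\<theta> - \<theta>'\<bar>"
proof -
  let ?B = "2 * pi * n * \<tau> ^ (weight n m + 1) * \<bar>\<theta> - \<theta>'\<bar>"
  have "cdist (embed n q (fast_arc n m \<tau> \<theta>)) (embed n q (fast_arc n m \<tau> \<theta>'))
      \<le> real (length (embed n q (fast_arc n m \<tau> \<theta>))) * ?B"
  proof (rule cdist_le_length_mult)
    fix i assume "i < length (embed n q (fast_arc n m \<tau> \<theta>))"
    then have i: "i < length (mons n q)" by simp
    obtain a b where ab: "mons n q ! i = (a, b)" by fastforce
    then have mem: "(a, b) \<in> set (mons n q)" using i nth_mem by metis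
    define k where "k = 2 * pi * (real a * snd m - real b * fst m) / n"
    have "embed n q (fast_arc n m \<tau> \<theta>) ! i - embed n q (fast_arc n m \<tau> \<theta>') ! i
        = of_real (\<tau> ^ weight n (a, b)) * (cis (k * \<theta>) - cis (k * \<theta>'))"
      unfolding nth_embed[OF i ab] monomial_fast_arc k_def by (simp add: right_diff_distrib)
    then have "cmod (embed n q (fast_arc n m \<tau> \<theta>) ! i - embed n q (fast_arc n m \<tau> \<theta>') ! i)
        = \<tau> ^ weight n (a, b) * norm (cis (k * \<theta>) - cis (k * \<theta>'))"
      using \<tau> by (simp add: norm_mult norm_power)
    also have "\<dots> \<le> \<tau> ^ weight n (a, b) * \<bar>k * \<theta> - k * \<theta>'\<bar>"
      using \<tau> by (intro mult_left_mono norm_cis_diff_le) auto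
    also have "\<bar>k * \<theta> - k * \<theta>'\<bar> = \<bar>k\<bar> * \<bar>\<theta> - \<theta>'\<bar>" by (simp flip: right_diff_distrib add: abs_mult)
    also have "\<tau> ^ weight n (a, b) * (\<bar>k\<bar> * \<bar>\<theta> - \<theta>'\<bar>) \<le> ?B"
    proof (cases "(a, b) = m")
      case True
      then have "k = 0" by (auto simp: k_def)
      then show ?thesis using \<tau> by simp
    next
      case False
      then have "\<tau> ^ weight n (a, b) \<le> \<tau> ^ (weight n m + 1)"
        using dom[OF mem] \<tau> by (intro power_decreasing) auto
      \<comment> \<open>All exponents are at most n, so the determinant in the phase velocity is at
        most n^2.\<close>
      moreover have "\<bar>k\<bar> \<le> 2 * pi * n"
      proof -
        have le: "a \<le> n" "b \<le> n" "fst m \<le> n" "snd m \<le> n"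
          using mem m by (cases m; auto simp: mons_iff)+
        have "real a * snd m \<le> real n * n" "real b * fst m \<le> real n * n"
          using le by (auto intro!: mult_mono)
        then have "\<bar>real a * snd m - real b * fst m\<bar> \<le> real n * n"
          using mult_nonneg_nonneg[of "real a" "real (snd m)"] mult_nonneg_nonneg[of "real b" "real (fst m)"]
          unfolding abs_le_iff by linarith
        then have "2 * pi / n * \<bar>real a * snd m - real b * fst m\<bar> \<le> 2 * pi / n * (real n * n)"
          by (intro mult_left_mono) auto
        then show ?thesis using n by (simp add: k_def abs_mult)
      qed
      ultimately have "\<tau> ^ weight n (a, b) * (\<bar>k\<bar> * \<bar>\<theta> - \<theta>'\<bar>)
          \<le> \<tau> ^ (weight n m + 1) * (2 * pi * n * \<bar>\<theta> - \<theta>'\<bar>)"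
        using \<tau> by (intro mult_mono) auto
      then show ?thesis by (simp add: mult_ac)
    qed
    finally show "cmod (embed n q (fast_arc n m \<tau> \<theta>) ! i - embed n q (fast_arc n m \<tau> \<theta>') ! i) \<le> ?B" .
  qed
  then show ?thesis by (simp add: mult.assoc)
qed

text \<open>The second coordinate turns by \<xi> = exp (-2 pi i a / n). Invariance of the monomial
  means q a = -b modulo n, so the first coordinate turns by \<open>\<xi> ^ q\<close>: the ends lie
  in one orbit. They differ because 0 < a < n gives \<xi> \<noteq> 1.\<close>

lemma fast_arc_endpoints:
  assumes "(a, b) \<in> set (mons n q)" "0 < a" "a < n" "0 < \<tau>"
  shows "embed n q (fast_arc n (a, b) \<tau> 0) = embed n q (fast_arc n (a, b) \<tau> 1)"
    and "fast_arc n (a, b) \<tau> 0 \<noteq> fast_arc n (a, b) \<tau> 1"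
proof -
  define \<xi> where "\<xi> = cis (- (2 * pi * a / n))"
  have n: "n > 0" using assms by simp
  have "\<xi> ^ n = cis (- (2 * pi * a))" using n by (simp add: \<xi>_def Complex.DeMoivre)
  also have "\<dots> = 1" using cis_multiple_2pi[of "- real a"] by (simp add: mult_ac)
  finally have \<xi>n: "\<xi> ^ n = 1" .
  obtain k where "q * a + b = n * k" using assms(1) by (auto simp: mons_iff)
  then have "real q * real a + real b = real n * real k" by (metis of_nat_add of_nat_mult)
  then have "real q * real a = real n * real k - real b" by linarith
  then have "- (2 * pi / n) * (real q * real a) = 2 * pi * b / n + 2 * pi * (- real k)"
    using n by (simp only:) (simp add: field_simps)
  then have "real q * (- (2 * pi * a / n)) = 2 * pi * b / n + 2 * pi * (- real k)" by (simp add: mult_ac)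
  then have "\<xi> ^ q = cis (2 * pi * b / n) * cis (2 * pi * (- real k))"
    unfolding \<xi>_def Complex.DeMoivre cis_mult by simp
  also have "cis (2 * pi * (- real k)) = 1" by (intro cis_multiple_2pi) simp
  finally have "fast_arc n (a, b) \<tau> 1 = act q \<xi> (fast_arc n (a, b) \<tau> 0)"
    by (simp add: fast_arc_def act_def \<xi>_def)
  then show "embed n q (fast_arc n (a, b) \<tau> 0) = embed n q (fast_arc n (a, b) \<tau> 1)"
    using embed_act[OF \<xi>n] by simp
  show "fast_arc n (a, b) \<tau> 0 \<noteq> fast_arc n (a, b) \<tau> 1"
    using cis_fraction_neq_1[OF assms(2,3)] assms(4) by (auto simp: fast_arc_def)
qed

section \<open>The non-homogeneous case\<close>

text \<open>At radii at least \<open>r0\<close>, a cone distance below 2 r0 forces an angle below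
  pi. The cap is then inactive, and the angle is the true inner distance in the link, which
  dominates the ambient one.\<close>

lemma cdist_le_of_cone_dist:
  assumes t: "0 < r0" "r0 \<le> t" "r0 \<le> s"
    and D: "cone_dist (inner_dist M) (Some (t, x)) (Some (s, y)) \<le> B" and B: "B < 2 * r0"
  shows "cdist x y \<le> pi / 2 * B / r0"
proof -
  define c where "c = cap_pi (inner_dist M x y)"
  have c0: "0 \<le> c" unfolding c_def by (intro cap_pi_nonneg inner_dist_nonneg)
  have "r0 \<le> sqrt (t * s)"
    using mult_mono[of r0 t r0 s] t by (intro real_le_rsqrt) (simp add: power2_eq_square)
  then have "2 / pi * r0 * c \<le> 2 / pi * sqrt (t * s) * c"
    using c0 by (intro mult_right_mono mult_left_mono) auto
  also have "\<dots> \<le> B"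
    using order_trans[OF angle_le_cone_dist[of t s "inner_dist M" x y] D] t by (simp add: c_def)
  finally have c: "c \<le> pi / 2 * B / r0" using t by (simp add: field_simps)
  also have "\<dots> < pi" using t B by (simp add: field_simps)
  finally have "ereal c = inner_dist M x y"
    unfolding c_def by (intro ereal_cap_pi) auto
  then have "cdist x y \<le> c" using cdist_le_inner_dist[of x y M] by (metis ereal_less_eq(3))
  then show ?thesis using c by simp
qed

lemma cone_dist_le_inner_dist:
  assumes "0 \<le> t" "0 \<le> s" "inner_dist M x y \<le> ereal d"
  shows "cone_dist (inner_dist M) (Some (t, x)) (Some (s, y)) \<le> \<bar>t - s\<bar> + sqrt (t * s) * d"
proof -
  have "sqrt (t * s) * cap_pi (inner_dist M x y) \<le> sqrt (t * s) * d"
    using assms by (intro mult_left_mono cap_pi_le) auto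
  then show ?thesis using cone_dist_le[of t s "inner_dist M" x y] assms by simp
qed

text \<open>The data of a hypothetical chart for q > 1, with the two metric bounds as separate
  assumptions; these assumptions are refuted below.\<close>

locale conical_chart =
  fixes n q :: nat and \<epsilon> r \<delta> K :: real and U and h :: "complex list \<Rightarrow> (real \<times> complex list) option"
  assumes n: "n \<ge> 2" and q1: "1 < q" and qn: "q < n" and cop: "coprime q n"
    and \<epsilon>: "\<epsilon> > 0" and r: "r > 0" and \<delta>: "\<delta> > 0" and K: "K \<ge> 1"
    and ball_U: "{x \<in> quotV n q. cnorm x < r} \<subseteq> U" and U_V: "U \<subseteq> quotV n q"
    and h_cone: "h ` U \<subseteq> cone_points (link n q \<epsilon>)"
    and cone_h: "{P \<in> cone_points (link n q \<epsilon>). cone_radius P < \<delta>} \<subseteq> h ` U"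
    and inj: "inj_on h U" and h_sing: "h (singpt n q) = None"
    and lower: "\<And>x y. \<lbrakk>x \<in> U; y \<in> U\<rbrakk> \<Longrightarrow>
        ereal (cone_dist (inner_dist (link n q \<epsilon>)) (h x) (h y)) \<le> ereal K * inner_dist (quotV n q) x y"
    and upper: "\<And>x y. \<lbrakk>x \<in> U; y \<in> U\<rbrakk> \<Longrightarrow>
        inner_dist (quotV n q) x y \<le> ereal K * ereal (cone_dist (inner_dist (link n q \<epsilon>)) (h x) (h y))"
begin

abbreviation "M \<equiv> link n q \<epsilon>"
abbreviation "D \<equiv> cone_dist (inner_dist M)"

lemma sing_U: "singpt n q \<in> U"
  using ball_U r by auto

lemma lower_real:
  assumes "x \<in> U" "y \<in> U" "inner_dist (quotV n q) x y \<le> ereal d"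
  shows "D (h x) (h y) \<le> K * d"
proof -
  have "ereal K * inner_dist (quotV n q) x y \<le> ereal K * ereal d"
    using assms(3) K by (intro ereal_mult_left_mono) auto
  from order_trans[OF lower[OF assms(1,2)] this] show ?thesis by simp
qed

lemma upper_real: "x \<in> U \<Longrightarrow> y \<in> U \<Longrightarrow> cdist x y \<le> K * D (h x) (h y)"
  using order_trans[OF cdist_le_inner_dist upper, of x y] by simp

text \<open>The image of the loop stays at radius at least \<tau>^w / K and moves at cone speed at
  most K A \<tau>^(w+1). Their quotient bounds its motion in the link by a multiple of \<tau>, with
  \<open>C\<close> independent of \<tau>.\<close>

lemma obtain_arc_image:
  assumes ab: "(a, b) \<in> set (mons n q)"
    and dom: "\<And>m. m \<in> set (mons n q) \<Longrightarrow> m = (a, b) \<or> weight n (a, b) < weight n m"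
  obtains \<tau>0 C where "0 < \<tau>0" "0 \<le> C"
    "\<And>\<tau>. \<lbrakk>0 < \<tau>; \<tau> < \<tau>0\<rbrakk> \<Longrightarrow> \<exists>s m.
        (\<forall>\<theta>\<in>{0..1}. embed n q (fast_arc n (a, b) \<tau> \<theta>) \<in> U \<and>
          h (embed n q (fast_arc n (a, b) \<tau> \<theta>)) = Some (s \<theta>, m \<theta>) \<and>
          0 < s \<theta> \<and> s \<theta> < \<delta> \<and> m \<theta> \<in> M) \<and>
        continuous_on {0..1} s \<and>
        (\<forall>\<theta>\<in>{0..1}. \<forall>\<theta>'\<in>{0..1}. cdist (m \<theta>) (m \<theta>') \<le> C * \<tau> * \<bar>\<theta> - \<theta>'\<bar>)"
proof -
  let ?V = "quotV n q"
  define w where "w = weight n (a, b)"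
  define A where "A = real (length (mons n q)) * (2 * pi * n)"
  have A: "0 \<le> A" by (simp add: A_def)
  obtain L where L: "L \<ge> 0" "\<And>u v. \<lbrakk>norm u \<le> 2; norm v \<le> 2\<rbrakk>
      \<Longrightarrow> cdist (embed n q u) (embed n q v) \<le> L * dist u v"
    using embed_lipschitz[of 2] by metis
  define C where "C = pi / 2 * K * K * A"
  \<comment> \<open>The entries ensure, in this order, that higher powers of \<tau> are smaller,
    that the loop lies in \<open>U\<close>, that its cone radius is below \<delta>, and that its
    cone distances stay below twice the minimal radius. The 1 in each denominator guards against
    \<open>L = 0\<close> or \<open>A = 0\<close>.\<close>
  define \<tau>0 where "\<tau>0 = Min {1, r / (2 * L + 1), \<delta> / (K * (2 * L + 1)), 2 / (K * K * A + 1)}"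
  have \<tau>0: "0 < \<tau>0"
    using r \<delta> K L A by (auto simp: \<tau>0_def intro!: divide_pos_pos mult_pos_pos add_nonneg_pos)
  have C0: "0 \<le> C" using K A by (simp add: C_def)
  show ?thesis
  proof (rule that[OF \<tau>0 C0])
    fix \<tau> assume \<tau>: "0 < \<tau>" "\<tau> < \<tau>0"
    have \<tau>1: "\<tau> \<le> 1" and "\<tau> < r / (2 * L + 1)" and "\<tau> < \<delta> / (K * (2 * L + 1))"
      and "\<tau> < 2 / (K * K * A + 1)"
      using \<tau> by (auto simp: \<tau>0_def)
    moreover have "0 < 2 * L + 1" "0 < K * (2 * L + 1)" "0 < K * K * A + 1"
      using L(1) K A by (auto intro!: mult_pos_pos add_nonneg_pos)
    ultimately have "\<tau> * (2 * L + 1) < r" "\<tau> * (K * (2 * L + 1)) < \<delta>" "\<tau> * (K * K * A + 1) < 2"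
      by (simp_all only: pos_less_divide_eq)
    moreover have "0 < K * \<tau>" using K \<tau> by simp
    ultimately have small: "L * (2 * \<tau>) < r" "K * (L * (2 * \<tau>)) < \<delta>" "K * (K * (A * \<tau>)) < 2"
      using \<tau> by (auto simp: algebra_simps)
    define x where "x \<theta> = embed n q (fast_arc n (a, b) \<tau> \<theta>)" for \<theta>
    have xV: "x \<theta> \<in> ?V" for \<theta> by (simp add: x_def)
    have arc: "norm (fast_arc n (a, b) \<tau> \<theta>) \<le> 2 * \<tau>" for \<theta>
      using norm_fast_arc_le \<tau> \<tau>1 by simp
    have radial: "inner_dist ?V (singpt n q) (x \<theta>) \<le> ereal (L * (2 * \<tau>))" for \<theta>
    proof -
      have "inner_dist ?V (embed n q 0) (x \<theta>) \<le> ereal (L * dist 0 (fast_arc n (a, b) \<tau> \<theta>))"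
        unfolding x_def using L \<tau>1 arc[of \<theta>]
        by (intro inner_dist_le_lipschitz_segment[of "cball 0 2"]) auto
      also have "\<dots> \<le> ereal (L * (2 * \<tau>))" using arc[of \<theta>] L(1) by (simp add: mult_left_mono)
      finally show ?thesis by (simp add: embed_0)
    qed
    have cdist_sing: "cdist (singpt n q) (x \<theta>) = cnorm (x \<theta>)" for \<theta>
      using cdist_commute[of "x \<theta>" "singpt n q"] by (simp add: x_def cnorm_def singpt_eq)
    have cnorm_ge: "\<tau> ^ w \<le> cnorm (x \<theta>)" for \<theta>
      using cnorm_fast_arc_ge[OF ab, of \<tau> \<theta>] \<tau> by (simp add: x_def w_def)
    have xU: "x \<theta> \<in> U" for \<theta>
    proof -
      have "cnorm (x \<theta>) \<le> L * (2 * \<tau>)"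
        using order_trans[OF cdist_le_inner_dist radial[of \<theta>]] by (simp add: cdist_sing)
      then show ?thesis using ball_U xV small(1) by auto
    qed
    have "x \<theta> \<noteq> singpt n q" for \<theta>
      using cnorm_ge[of \<theta>] \<tau> zero_less_power[of \<tau> w] by (metis cnorm_singpt not_less)
    then have "h (x \<theta>) \<noteq> None" for \<theta>
      using inj h_sing xU sing_U by (metis inj_onD)
    then have "\<exists>p. h (x \<theta>) = Some p \<and> 0 < fst p \<and> snd p \<in> M" for \<theta>
      using h_cone xU[of \<theta>] by (force simp: cone_points_def)
    then obtain p where p: "\<And>\<theta>. h (x \<theta>) = Some (p \<theta>)" "\<And>\<theta>. 0 < fst (p \<theta>)" "\<And>\<theta>. snd (p \<theta>) \<in> M"
      by metis
    define s m where "s \<theta> = fst (p \<theta>)" and "m \<theta> = snd (p \<theta>)" for \<theta>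
    have h_x: "h (x \<theta>) = Some (s \<theta>, m \<theta>)" for \<theta> by (simp add: p s_def m_def)
    have s_lt: "s \<theta> < \<delta>" for \<theta>
      using lower_real[OF sing_U xU radial, of \<theta>] small(2) by (simp add: h_sing h_x)
    have s_ge: "\<tau> ^ w / K \<le> s \<theta>" for \<theta>
      using upper_real[OF sing_U xU, of \<theta>] cnorm_ge[of \<theta>] K
      by (simp add: h_sing h_x cdist_sing field_simps)
    have speed: "D (Some (s \<theta>, m \<theta>)) (Some (s \<theta>', m \<theta>')) \<le> K * (A * \<tau> ^ (w + 1) * \<bar>\<theta> - \<theta>'\<bar>)" for \<theta> \<theta>'
    proof -
      have "inner_dist ?V (x \<theta>) (x \<theta>') \<le> ereal ((A * \<tau> ^ (w + 1)) * dist \<theta> \<theta>')"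
      proof (rule inner_dist_le_lipschitz_segment[of UNIV _ _ _ x])
        show "0 \<le> A * \<tau> ^ (w + 1)" using A \<tau> by simp
        show "x ` UNIV \<subseteq> ?V" using xV by auto
        fix y z :: real
        show "cdist (x y) (x z) \<le> A * \<tau> ^ (w + 1) * dist y z"
          using fast_arc_speed[OF ab _ \<tau>1 _ dom, of y z] \<tau> n
          by (simp add: x_def A_def w_def dist_real_def)
      qed auto
      then show ?thesis
        using lower_real[OF xU xU, of \<theta> \<theta>'] by (simp add: dist_real_def h_x)
    qed
    have "continuous_on {0..1} s"
    proof (rule lipschitz_on_continuous_on, rule lipschitz_onI)
      show "0 \<le> K * (A * \<tau> ^ (w + 1))" using K A \<tau> by simp
      fix \<theta> \<theta>'
      have "\<bar>s \<theta> - s \<theta>'\<bar> \<le> D (Some (s \<theta>, m \<theta>)) (Some (s \<theta>', m \<theta>'))"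
        using p(2) by (intro abs_diff_le_cone_dist) (auto simp: s_def less_imp_le)
      then show "dist (s \<theta>) (s \<theta>') \<le> K * (A * \<tau> ^ (w + 1)) * dist \<theta> \<theta>'"
        using speed[of \<theta> \<theta>'] by (simp add: dist_real_def mult.assoc)
    qed
    moreover have "cdist (m \<theta>) (m \<theta>') \<le> C * \<tau> * \<bar>\<theta> - \<theta>'\<bar>" if \<theta>: "\<theta> \<in> {0..1}" "\<theta>' \<in> {0..1}" for \<theta> \<theta>'
    proof -
      have pos: "0 < \<tau> ^ w / K" using \<tau> K by simp
      have "K * (A * \<tau> ^ (w + 1) * \<bar>\<theta> - \<theta>'\<bar>) \<le> K * (A * \<tau> ^ (w + 1) * 1)"
        using \<theta> K A \<tau> by (intro mult_left_mono) auto
      also have "\<dots> = K * (K * (A * \<tau>)) * (\<tau> ^ w / K)" using K by simp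
      also have "\<dots> < 2 * (\<tau> ^ w / K)" using small(3) pos by (intro mult_strict_right_mono)
      finally have "cdist (m \<theta>) (m \<theta>') \<le> pi / 2 * (K * (A * \<tau> ^ (w + 1) * \<bar>\<theta> - \<theta>'\<bar>)) / (\<tau> ^ w / K)"
        by (intro cdist_le_of_cone_dist[OF pos s_ge s_ge speed])
      also have "\<dots> = C * \<tau> * \<bar>\<theta> - \<theta>'\<bar>" using \<tau> by (simp add: C_def field_simps)
      finally show ?thesis .
    qed
    ultimately show "\<exists>s m.
        (\<forall>\<theta>\<in>{0..1}. embed n q (fast_arc n (a, b) \<tau> \<theta>) \<in> U \<and>
          h (embed n q (fast_arc n (a, b) \<tau> \<theta>)) = Some (s \<theta>, m \<theta>) \<and>
          0 < s \<theta> \<and> s \<theta> < \<delta> \<and> m \<theta> \<in> M) \<and>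
        continuous_on {0..1} s \<and>
        (\<forall>\<theta>\<in>{0..1}. \<forall>\<theta>'\<in>{0..1}. cdist (m \<theta>) (m \<theta>') \<le> C * \<tau> * \<bar>\<theta> - \<theta>'\<bar>)"
      using xU h_x s_lt p(2,3) unfolding x_def by (intro exI[of _ s] exI[of _ m]) (auto simp: s_def m_def)
  qed
qed

text \<open>The chart is simply connected, so the inverse of \<open>h\<close> lifts to the universal cover over it.\<close>

lemma obtain_lifted_chart:
  fixes w :: "complex \<times> complex"
  assumes w: "0 \<notin> cball w e"
    and L: "\<And>v. v \<in> cball w e \<Longrightarrow> \<Phi> v \<in> M"
    "\<And>u v. \<lbrakk>u \<in> cball w e; v \<in> cball w e\<rbrakk> \<Longrightarrow> inner_dist M (\<Phi> u) (\<Phi> v) \<le> ereal (L * dist u v)"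
  obtains \<Psi> where "continuous_on ({0<..<\<delta>} \<times> ball w e) \<Psi>"
    "\<And>s v. \<lbrakk>s \<in> {0<..<\<delta>}; v \<in> ball w e\<rbrakk> \<Longrightarrow> \<Psi> (s, v) \<noteq> 0 \<and>
      embed n q (\<Psi> (s, v)) = inv_into U h (Some (s, \<Phi> v))"
proof -
  have q0: "0 < q" using q1 by simp
  let ?p = "coords n q"
  obtain \<kappa> where \<kappa>: "\<And>u. \<kappa> (embed n q u) = ?p u"
    "\<And>x y. \<lbrakk>x \<in> quotV n q; y \<in> quotV n q\<rbrakk> \<Longrightarrow> dist (\<kappa> x) (\<kappa> y) \<le> 3 * cdist x y"
    using obtain_list_coords[OF n q0 qn cop] by blast
  let ?W = "{0<..<\<delta>} \<times> ball w e"
  define g where "g = (\<lambda>(s, v). inv_into U h (Some (s, \<Phi> v)))"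
  have hit: "Some (s, \<Phi> v) \<in> h ` U" if "(s, v) \<in> ?W" for s v
    using that cone_h L(1)[of v] by (force simp: cone_points_def)
  have gU: "g x \<in> U" if "x \<in> ?W" for x
    using that hit by (auto simp: g_def intro: inv_into_into)
  have hg: "h (g (s, v)) = Some (s, \<Phi> v)" if "(s, v) \<in> ?W" for s v
    using hit[OF that] by (simp add: g_def f_inv_into_f)
  \<comment> \<open>The upper metric bound controls the inverse chart by the cone distance, which is
    in turn bounded by the change of radius and the Lipschitz estimate for \<Phi>; that majorant
    \<open>B\<close> tends to 0.\<close>
  have cont: "continuous_on ?W (\<lambda>x. \<kappa> (g x))"
    unfolding continuous_on_eq_continuous_within
  proof
    fix x assume x: "x \<in> ?W"
    obtain s v where sv: "x = (s, v)" by (cases x)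
    define B where "B y = 3 * (K * (\<bar>s - fst y\<bar> + sqrt (s * fst y) * (L * dist v (snd y))))" for y
    have le: "dist (\<kappa> (g y)) (\<kappa> (g x)) \<le> B y" if y: "y \<in> ?W" for y
    proof -
      obtain s' v' where y_eq: "y = (s', v')" by (cases y)
      have in_V: "g x \<in> quotV n q" "g y \<in> quotV n q" using gU x y U_V by blast+
      have "dist (\<kappa> (g y)) (\<kappa> (g x)) \<le> 3 * cdist (g x) (g y)"
        using \<kappa>(2)[OF in_V] by (simp add: dist_commute)
      also have "\<dots> \<le> 3 * (K * D (h (g x)) (h (g y)))"
        using upper_real gU x y by (intro mult_left_mono) auto
      finally have "dist (\<kappa> (g y)) (\<kappa> (g x)) \<le> 3 * (K * D (h (g x)) (h (g y)))" .
      moreover have "3 * (K * D (h (g x)) (h (g y))) \<le> B y"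
      proof -
        have "D (h (g x)) (h (g y)) \<le> \<bar>s - s'\<bar> + sqrt (s * s') * (L * dist v v')"
          unfolding sv y_eq hg[OF x[unfolded sv]] hg[OF y[unfolded y_eq]]
          using x y by (intro cone_dist_le_inner_dist L(2)) (simp_all add: sv y_eq)
        then have "K * D (h (g x)) (h (g y)) \<le> K * (\<bar>s - s'\<bar> + sqrt (s * s') * (L * dist v v'))"
          using K by (simp only: mult_left_mono)
        moreover have "B y = 3 * (K * (\<bar>s - s'\<bar> + sqrt (s * s') * (L * dist v v')))"
          by (simp add: B_def y_eq)
        ultimately show ?thesis by linarith
      qed
      ultimately show ?thesis by linarith
    qed
    have "(B \<longlongrightarrow> B x) (at x within ?W)"
      unfolding B_def by (intro tendsto_intros)
    moreover have "B x = 0" by (simp add: B_def sv)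
    ultimately have B0: "(B \<longlongrightarrow> 0) (at x within ?W)" by simp
    have "norm (dist (\<kappa> (g y)) (\<kappa> (g x))) \<le> B y" if "y \<in> ?W" for y
      using le[OF that] by simp
    then have "eventually (\<lambda>y. norm (dist (\<kappa> (g y)) (\<kappa> (g x))) \<le> B y) (at x within ?W)"
      unfolding eventually_at_filter by (intro always_eventually) blast
    then have "((\<lambda>y. dist (\<kappa> (g y)) (\<kappa> (g x))) \<longlongrightarrow> 0) (at x within ?W)"
      using B0 by (rule Lim_null_comparison)
    then show "continuous (at x within ?W) (\<lambda>x. \<kappa> (g x))"
      unfolding continuous_within by (rule iffD2[OF tendsto_dist_iff])
  qed
  have nz: "\<exists>u. u \<noteq> 0 \<and> g x = embed n q u" if x: "x \<in> ?W" for x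
  proof -
    obtain u where u: "g x = embed n q u" using gU[OF x] U_V by (auto simp: quotV_def)
    have "u \<noteq> 0"
    proof
      assume "u = 0"
      then have "h (g x) = None" by (simp add: u embed_0 h_sing)
      then show False using hg x by (cases x) auto
    qed
    then show ?thesis using u by blast
  qed
  have im: "(\<lambda>x. \<kappa> (g x)) \<in> ?W \<rightarrow> ?p ` (- {0})"
  proof
    fix x assume "x \<in> ?W"
    then obtain u where "u \<noteq> 0" "g x = embed n q u" using nz by blast
    then show "\<kappa> (g x) \<in> ?p ` (- {0})" using \<kappa>(1) by auto
  qed
  \<comment> \<open>Convexity provides both topological hypotheses of the lifting theorem.\<close>
  have "convex ?W" by (intro convex_Times convex_real_interval convex_ball)
  then obtain \<Psi> where \<Psi>: "continuous_on ?W \<Psi>" "\<Psi> \<in> ?W \<rightarrow> - {0}" "\<And>y. y \<in> ?W \<Longrightarrow> ?p (\<Psi> y) = \<kappa> (g y)"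
    using covering_space_lift[OF covering_space_coords[OF n q0 qn cop] convex_imp_simply_connected
        convex_imp_locally_path_connected cont im] by blast
  show ?thesis
  proof (rule that[OF \<Psi>(1)])
    fix s v assume "s \<in> {0<..<\<delta>}" "v \<in> ball w e"
    then have x: "(s, v) \<in> ?W" by simp
    then obtain u where u: "g (s, v) = embed n q u" using nz by blast
    \<comment> \<open>The lift respects only three monomials so far. They separate orbits and
      \<open>embed\<close> is constant on orbits, so all coordinates agree.\<close>
    then have "?p u = ?p (\<Psi> (s, v))" using \<Psi>(3)[OF x] \<kappa>(1) by simp
    then obtain \<xi> where "\<xi> ^ n = 1" "\<Psi> (s, v) = act q \<xi> u"
      using coords_eq_imp_act[OF n q0 qn cop] by blast
    then have "embed n q (\<Psi> (s, v)) = g (s, v)" using embed_act u by simp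
    then show "\<Psi> (s, v) \<noteq> 0 \<and> embed n q (\<Psi> (s, v)) = inv_into U h (Some (s, \<Phi> v))"
      using \<Psi>(2) x by (auto simp: g_def)
  qed
qed

text \<open>Two lifts of the same fast loop are compared: one through the lifted chart, closed
  because it depends only on the chart image, and one given by the arc itself, which is not
  closed.\<close>

lemma impossible: False
proof -
  have q0: "0 < q" using q1 by simp
  have n1: "n \<ge> 1" using n by simp
  let ?p = "coords n q" and ?S = "coords n q ` (- {0})"
  obtain \<kappa> where \<kappa>: "\<And>u. \<kappa> (embed n q u) = ?p u"
    "\<And>x y. \<lbrakk>x \<in> quotV n q; y \<in> quotV n q\<rbrakk> \<Longrightarrow> dist (\<kappa> x) (\<kappa> y) \<le> 3 * cdist x y"
    using obtain_list_coords[OF n q0 qn cop] by blast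
  obtain a b where ab: "(a, b) \<in> set (mons n q)" "0 < a" "a < n"
    "\<And>m. m \<in> set (mons n q) \<Longrightarrow> m = (a, b) \<or> weight n (a, b) < weight n m"
    using obtain_dominant_monomial[OF n q1 qn] by blast
  define arc where "arc = fast_arc n (a, b)"
  obtain \<tau>0 C where \<tau>0: "0 < \<tau>0" "0 \<le> C"
    and ex_img: "\<And>\<tau>. \<lbrakk>0 < \<tau>; \<tau> < \<tau>0\<rbrakk> \<Longrightarrow> \<exists>s m.
        (\<forall>\<theta>\<in>{0..1}. embed n q (arc \<tau> \<theta>) \<in> U \<and> h (embed n q (arc \<tau> \<theta>)) = Some (s \<theta>, m \<theta>) \<and>
          0 < s \<theta> \<and> s \<theta> < \<delta> \<and> m \<theta> \<in> M) \<and>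
        continuous_on {0..1} s \<and>
        (\<forall>\<theta>\<in>{0..1}. \<forall>\<theta>'\<in>{0..1}. cdist (m \<theta>) (m \<theta>') \<le> C * \<tau> * \<bar>\<theta> - \<theta>'\<bar>)"
    unfolding arc_def using obtain_arc_image[OF ab(1,4)] by metis
  \<comment> \<open>The shift by 2 makes even the term for \<open>k = 0\<close> strictly smaller
    than \<open>\<tau>0\<close>.\<close>
  define \<tau> where "\<tau> k = \<tau>0 * inverse (real (Suc (Suc k)))" for k
  have \<tau>_pos: "0 < \<tau> k" for k using \<tau>0 by (simp add: \<tau>_def)
  have \<tau>_lt: "\<tau> k < \<tau>0" for k using \<tau>0 by (simp add: \<tau>_def field_simps add_pos_nonneg)
  have \<tau>_lim: "\<tau> \<longlonglongrightarrow> 0"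
    unfolding \<tau>_def using tendsto_mult_right_zero[OF LIMSEQ_Suc[OF LIMSEQ_inverse_real_of_nat]] by simp
  have "\<forall>k. \<exists>s m.
        (\<forall>\<theta>\<in>{0..1}. embed n q (arc (\<tau> k) \<theta>) \<in> U \<and> h (embed n q (arc (\<tau> k) \<theta>)) = Some (s \<theta>, m \<theta>) \<and>
          0 < s \<theta> \<and> s \<theta> < \<delta> \<and> m \<theta> \<in> M) \<and>
        continuous_on {0..1} s \<and>
        (\<forall>\<theta>\<in>{0..1}. \<forall>\<theta>'\<in>{0..1}. cdist (m \<theta>) (m \<theta>') \<le> C * \<tau> k * \<bar>\<theta> - \<theta>'\<bar>)"
    using ex_img[OF \<tau>_pos \<tau>_lt] by blast
  from this[THEN choice] obtain sk where "\<forall>k. \<exists>m.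
        (\<forall>\<theta>\<in>{0..1}. embed n q (arc (\<tau> k) \<theta>) \<in> U \<and> h (embed n q (arc (\<tau> k) \<theta>)) = Some (sk k \<theta>, m \<theta>) \<and>
          0 < sk k \<theta> \<and> sk k \<theta> < \<delta> \<and> m \<theta> \<in> M) \<and>
        continuous_on {0..1} (sk k) \<and>
        (\<forall>\<theta>\<in>{0..1}. \<forall>\<theta>'\<in>{0..1}. cdist (m \<theta>) (m \<theta>') \<le> C * \<tau> k * \<bar>\<theta> - \<theta>'\<bar>)" ..
  from this[THEN choice] obtain mk where img:
    "\<And>k \<theta>. \<theta> \<in> {0..1} \<Longrightarrow> embed n q (arc (\<tau> k) \<theta>) \<in> U"
    "\<And>k \<theta>. \<theta> \<in> {0..1} \<Longrightarrow> h (embed n q (arc (\<tau> k) \<theta>)) = Some (sk k \<theta>, mk k \<theta>)"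
    "\<And>k \<theta>. \<theta> \<in> {0..1} \<Longrightarrow> sk k \<theta> \<in> {0<..<\<delta>}"
    "\<And>k \<theta>. \<theta> \<in> {0..1} \<Longrightarrow> mk k \<theta> \<in> M"
    "\<And>k. continuous_on {0..1} (sk k)"
    "\<And>k \<theta> \<theta>'. \<lbrakk>\<theta> \<in> {0..1}; \<theta>' \<in> {0..1}\<rbrakk> \<Longrightarrow> cdist (mk k \<theta>) (mk k \<theta>') \<le> C * \<tau> k * \<bar>\<theta> - \<theta>'\<bar>"
    by (auto simp del: atLeastAtMost_iff)
  have "\<exists>u. mk k 0 = embed n q u \<and> cnorm (embed n q u) = \<epsilon>" for k
  proof -
    have "mk k 0 \<in> quotV n q" "cnorm (mk k 0) = \<epsilon>" using img(4)[of 0 k] by (auto simp: link_def)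
    then obtain z where "mk k 0 = embed n q z" by (auto simp: quotV_def)
    then show ?thesis using \<open>cnorm (mk k 0) = \<epsilon>\<close> by (intro exI[of _ z]) simp
  qed
  then obtain u where u: "\<And>k. mk k 0 = embed n q (u k)" "\<And>k. cnorm (embed n q (u k)) = \<epsilon>" by metis
  have "bounded (range u)"
    unfolding bounded_iff using norm_le_gauge[OF n1, of _ q] u(2) by (metis imageE)
  \<comment> \<open>The starting points in the link, represented upstairs, accumulate at
    \<open>w\<close>, about which the chart neighbourhood is placed.\<close>
  then obtain w \<phi> where w: "strict_mono \<phi>" "(u \<circ> \<phi>) \<longlonglongrightarrow> w"
    using bounded_imp_convergent_subsequence by blast
  have "(\<lambda>k. cnorm (embed n q ((u \<circ> \<phi>) k))) \<longlonglongrightarrow> cnorm (embed n q w)"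
    using continuous_on_tendsto_compose[OF continuous_on_gauge[of UNIV] w(2)] by simp
  then have "cnorm (embed n q w) = \<epsilon>" using u(2) by (simp add: LIMSEQ_const_iff)
  then have w0: "w \<noteq> 0" using \<epsilon> by (auto simp: embed_0)
  define e where "e = norm w / 2"
  have e: "0 < e" "0 \<notin> cball w e" using w0 by (auto simp: e_def)
  obtain \<Phi> L where \<Phi>: "\<And>v. v \<in> cball w e \<Longrightarrow> \<Phi> v \<in> M"
    "\<And>v. \<lbrakk>v \<in> cball w e; cnorm (embed n q v) = \<epsilon>\<rbrakk> \<Longrightarrow> \<Phi> v = embed n q v"
    "\<And>u v. \<lbrakk>u \<in> cball w e; v \<in> cball w e\<rbrakk> \<Longrightarrow> inner_dist M (\<Phi> u) (\<Phi> v) \<le> ereal (L * dist u v)"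
    using obtain_radial_projection[OF n1 \<epsilon> e(2)] by metis
  obtain d \<sigma> where d: "d > 0" and \<sigma>: "continuous_on (?S \<inter> ball (?p w) d) \<sigma>"
    "\<And>x. x \<in> ?S \<inter> ball (?p w) d \<Longrightarrow> \<sigma> x \<in> ball w e \<and> ?p (\<sigma> x) = x"
    using local_section_coords[OF n q0 qn cop w0 e(1)] by blast
  have "(\<lambda>k. ?p ((u \<circ> \<phi>) k)) \<longlonglongrightarrow> ?p w"
    using continuous_on_tendsto_compose[OF continuous_on_coords[of UNIV] w(2)] by simp
  moreover have "(\<lambda>k. \<tau> (\<phi> k)) \<longlonglongrightarrow> 0"
    using LIMSEQ_subseq_LIMSEQ[OF \<tau>_lim w(1)] by (simp add: o_def)
  \<comment> \<open>The first summand bounds the drift of the trace under \<kappa>, the second the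
    distance of its start from the image of \<open>w\<close>. Once their sum is below
    \<open>d\<close>, the whole trace lies in the domain of the section.\<close>
  ultimately have "(\<lambda>k. 3 * (C * \<tau> (\<phi> k)) + dist (?p ((u \<circ> \<phi>) k)) (?p w))
      \<longlonglongrightarrow> 3 * (C * 0) + dist (?p w) (?p w)"
    by (intro tendsto_intros)
  then have "eventually (\<lambda>k. 3 * (C * \<tau> (\<phi> k)) + dist (?p ((u \<circ> \<phi>) k)) (?p w) < d) sequentially"
    using d by (intro order_tendstoD(2)) auto
  then obtain k0 where "3 * (C * \<tau> (\<phi> k0)) + dist (?p ((u \<circ> \<phi>) k0)) (?p w) < d"
    using eventually_happens by force
  then obtain k where k: "3 * (C * \<tau> k) + dist (?p (u k)) (?p w) < d" by auto
  let ?I = "{0..1::real}"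
  define m s where "m = mk k" and "s = sk k"
  define x where "x \<theta> = embed n q (arc (\<tau> k) \<theta>)" for \<theta>
  have hx: "x \<theta> \<in> U" "h (x \<theta>) = Some (s \<theta>, m \<theta>)" if "\<theta> \<in> ?I" for \<theta>
    using img(1,2)[OF that] by (auto simp: x_def s_def m_def)
  have mM: "m \<theta> \<in> quotV n q" "cnorm (m \<theta>) = \<epsilon>" if "\<theta> \<in> ?I" for \<theta>
    using img(4)[OF that, of k] by (auto simp: m_def link_def)
  have m_lip: "dist (\<kappa> (m \<theta>)) (\<kappa> (m \<theta>')) \<le> 3 * (C * \<tau> k) * dist \<theta> \<theta>'" if "\<theta> \<in> ?I" "\<theta>' \<in> ?I" for \<theta> \<theta>'
    using \<kappa>(2)[OF mM(1) mM(1), OF that] img(6)[OF that, of k] by (simp add: m_def dist_real_def)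
  have \<kappa>m_S: "\<kappa> (m \<theta>) \<in> ?S \<inter> ball (?p w) d" if \<theta>: "\<theta> \<in> ?I" for \<theta>
  proof
    obtain v where v: "m \<theta> = embed n q v" using mM(1)[OF \<theta>] by (auto simp: quotV_def)
    have "v \<noteq> 0" using mM(2)[OF \<theta>] \<epsilon> by (auto simp: v embed_0)
    then show "\<kappa> (m \<theta>) \<in> ?S" using v \<kappa>(1) by auto
    have "dist (\<kappa> (m \<theta>)) (?p (u k)) \<le> 3 * (C * \<tau> k) * dist \<theta> 0"
      using m_lip[OF \<theta>, of 0] u(1)[of k] \<kappa>(1) by (simp add: m_def)
    also have "\<dots> \<le> 3 * (C * \<tau> k) * 1"
      using \<theta> \<tau>0 \<tau>_pos[of k] by (intro mult_left_mono) (auto simp: dist_real_def)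
    finally show "\<kappa> (m \<theta>) \<in> ball (?p w) d"
      using k dist_triangle[of "\<kappa> (m \<theta>)" "?p w" "?p (u k)"] by (simp add: dist_commute)
  qed
  \<comment> \<open>Applying the section pointwise, instead of lifting the path, makes
    \<open>v\<close> depend only on the point of the link; hence it is closed.\<close>
  define v where "v \<theta> = \<sigma> (\<kappa> (m \<theta>))" for \<theta>
  have v_ball: "v \<theta> \<in> ball w e" and v_p: "?p (v \<theta>) = \<kappa> (m \<theta>)" if "\<theta> \<in> ?I" for \<theta>
    using \<sigma>(2)[OF \<kappa>m_S[OF that]] by (auto simp: v_def)
  have v_cont: "continuous_on ?I v"
    unfolding v_def
  proof (rule continuous_on_compose2[OF \<sigma>(1)])
    show "continuous_on ?I (\<lambda>\<theta>. \<kappa> (m \<theta>))"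
    proof (rule lipschitz_on_continuous_on, rule lipschitz_onI)
      show "0 \<le> 3 * (C * \<tau> k)" using \<tau>0 \<tau>_pos[of k] by simp
    qed (rule m_lip)
    show "(\<lambda>\<theta>. \<kappa> (m \<theta>)) ` ?I \<subseteq> ?S \<inter> ball (?p w) d" using \<kappa>m_S by blast
  qed
  \<comment> \<open>The point \<open>v \<theta>\<close> already lies over the link, where the radial
    projection changes nothing.\<close>
  have \<Phi>v: "\<Phi> (v \<theta>) = m \<theta>" if \<theta>: "\<theta> \<in> ?I" for \<theta>
  proof -
    obtain z where z: "m \<theta> = embed n q z" using mM(1)[OF \<theta>] by (auto simp: quotV_def)
    then have "?p z = ?p (v \<theta>)" using v_p[OF \<theta>] \<kappa>(1) by simp
    then obtain \<xi> where "\<xi> ^ n = 1" "v \<theta> = act q \<xi> z" using coords_eq_imp_act[OF n q0 qn cop] by blast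
    then have "embed n q (v \<theta>) = m \<theta>" using embed_act z by simp
    moreover have "v \<theta> \<in> cball w e" using v_ball[OF \<theta>] by simp
    ultimately show ?thesis using \<Phi>(2) mM(2)[OF \<theta>] by metis
  qed
  obtain \<Psi> where \<Psi>: "continuous_on ({0<..<\<delta>} \<times> ball w e) \<Psi>"
    "\<And>s v. \<lbrakk>s \<in> {0<..<\<delta>}; v \<in> ball w e\<rbrakk> \<Longrightarrow> \<Psi> (s, v) \<noteq> 0 \<and>
      embed n q (\<Psi> (s, v)) = inv_into U h (Some (s, \<Phi> v))"
    using obtain_lifted_chart[OF e(2) \<Phi>(1,3)] by metis
  define \<psi> where "\<psi> \<theta> = \<Psi> (s \<theta>, v \<theta>)" for \<theta>
  have sv: "s \<theta> \<in> {0<..<\<delta>}" "v \<theta> \<in> ball w e" if "\<theta> \<in> ?I" for \<theta>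
    using img(3)[OF that, of k] v_ball[OF that] by (auto simp: s_def)
  have \<psi>_cont: "continuous_on ?I \<psi>"
    unfolding \<psi>_def using sv img(5)[of k] v_cont
    by (intro continuous_on_compose2[OF \<Psi>(1)] continuous_on_Pair) (auto simp: s_def)
  have \<psi>_embed: "embed n q (\<psi> \<theta>) = x \<theta>" and \<psi>_nz: "\<psi> \<theta> \<noteq> 0" if \<theta>: "\<theta> \<in> ?I" for \<theta>
    using \<Psi>(2)[OF sv[OF \<theta>]] hx[OF \<theta>] inv_into_f_f[OF inj, of "x \<theta>"] \<Phi>v[OF \<theta>] by (auto simp: \<psi>_def)
  have \<psi>_p: "?p (\<psi> \<theta>) = ?p (arc (\<tau> k) \<theta>)" if "\<theta> \<in> ?I" for \<theta>
    using \<psi>_embed[OF that] \<kappa>(1) by (metis x_def)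
  \<comment> \<open>The two lifts may start at different points of the fibre; a group element aligns
    them before uniqueness is applied.\<close>
  then obtain \<xi> where \<xi>: "\<xi> ^ n = 1" "arc (\<tau> k) 0 = act q \<xi> (\<psi> 0)"
    using coords_eq_imp_act[OF n q0 qn cop, of "\<psi> 0" "arc (\<tau> k) 0"] by auto
  have \<xi>0: "\<xi> \<noteq> 0" using \<xi>(1) n by (auto simp: power_0_left)
  have arc_nz: "arc (\<tau> k) \<theta> \<noteq> 0" for \<theta>
    using \<tau>_pos[of k] by (auto simp: arc_def fast_arc_def prod_eq_iff)
  have "arc (\<tau> k) 1 = act q \<xi> (\<psi> 1)"
  proof (rule covering_space_lift_unique[OF covering_space_coords[OF n q0 qn cop],
        where ?g1.0 = "arc (\<tau> k)" and ?g2.0 = "\<lambda>\<theta>. act q \<xi> (\<psi> \<theta>)" and a = 0 and T = ?I])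
    show "continuous_on ?I (\<lambda>\<theta>. ?p (arc (\<tau> k) \<theta>))"
      by (rule continuous_on_compose2[OF continuous_on_coords[of UNIV]])
        (auto simp: arc_def continuous_on_fast_arc)
    show "(\<lambda>\<theta>. ?p (arc (\<tau> k) \<theta>)) \<in> ?I \<rightarrow> ?S" using arc_nz by auto
    show "continuous_on ?I (arc (\<tau> k))" by (simp add: arc_def continuous_on_fast_arc)
    show "continuous_on ?I (\<lambda>\<theta>. act q \<xi> (\<psi> \<theta>))"
      by (rule continuous_on_compose2[OF continuous_on_act[of UNIV] \<psi>_cont]) auto
    show "(\<lambda>\<theta>. act q \<xi> (\<psi> \<theta>)) \<in> ?I \<rightarrow> - {0}" using \<psi>_nz act_eq_0_iff[OF \<xi>0] by auto
    show "?p (arc (\<tau> k) \<theta>) = ?p (act q \<xi> (\<psi> \<theta>))" if "\<theta> \<in> ?I" for \<theta>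
      using \<psi>_p[OF that] coords_act[OF n q0 qn cop \<xi>(1)] by simp
  qed (use arc_nz \<xi>(2) in auto)
  \<comment> \<open>The loop closes in V, so its radius and its link point return to their initial
    values, and these determine \<psi>.\<close>
  moreover have "\<psi> 1 = \<psi> 0"
  proof -
    have "x 0 = x 1" using fast_arc_endpoints(1)[OF ab(1-3) \<tau>_pos] by (simp add: x_def arc_def)
    then have "s 0 = s 1" "m 0 = m 1" using hx[of 0] hx[of 1] by auto
    then show ?thesis by (simp add: \<psi>_def v_def)
  qed
  ultimately have "arc (\<tau> k) 0 = arc (\<tau> k) 1" using \<xi>(2) by simp
  then show False using fast_arc_endpoints(2)[OF ab(1-3) \<tau>_pos, of k] by (simp add: arc_def)
qed

end

theorem theorem2:
  fixes n q :: nat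
  assumes "n \<ge> 2" and "0 < q" and "q < n" and "coprime q n"
  shows "metrically_conical n q \<longleftrightarrow> q = 1"
proof
  assume "q = 1"
  then show "metrically_conical n q" using metrically_conical_homogeneous assms(1) by simp
next
  assume mc: "metrically_conical n q"
  show "q = 1"
  proof (rule ccontr)
    assume "q \<noteq> 1"
    then have "1 < q" using assms(2) by simp
    obtain \<epsilon> r \<delta> K U h where c: "\<epsilon> > 0" "r > 0" "\<delta> > 0" "K \<ge> 1"
      "{x \<in> quotV n q. cnorm x < r} \<subseteq> U" "U \<subseteq> quotV n q"
      "h ` U \<subseteq> cone_points (link n q \<epsilon>)"
      "{P \<in> cone_points (link n q \<epsilon>). cone_radius P < \<delta>} \<subseteq> h ` U"
      "inj_on h U" "h (singpt n q) = None"
      "\<forall>x\<in>U. \<forall>y\<in>U.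
        ereal (cone_dist (inner_dist (link n q \<epsilon>)) (h x) (h y)) \<le> ereal K * inner_dist (quotV n q) x y \<and>
        inner_dist (quotV n q) x y \<le> ereal K * ereal (cone_dist (inner_dist (link n q \<epsilon>)) (h x) (h y))"
      using mc unfolding metrically_conical_def Let_def by (elim exE conjE) (rule that)
    have "conical_chart n q \<epsilon> r \<delta> K U h"
      using assms \<open>1 < q\<close> c(1-10) c(11)[rule_format, THEN conjunct1] c(11)[rule_format, THEN conjunct2]
      by (intro conical_chart.intro)
    then show False by (rule conical_chart.impossible)
  qed
qed

end
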